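(* For the stationary Gauss-Markov input $u_t=d'\tilde s_{s,t}+\mathcal E_t$ (described in the context) to achieve $C_\infty(\mathcal P)$, it must hold that $K_{\mathcal E}=0$. That is, if $(d,K_{\mathcal E})$ (with associated $\Sigma_s$) attains the maximum in $$C_\infty(\mathcal P)=\max_{d\in\mathbb R^m,\ K_{\mathcal E}\in\mathbb R}\ \tfrac12\log\big(1+K_{\mathcal E}+(H+d')\Sigma_s(H+d')'\big)$$ subject to $$\Sigma_s=Q\Sigma_sQ'+K_{\mathcal E}GG'-\frac{(Q\Sigma_s(H+d')'+K_{\mathcal E}G)(Q\Sigma_s(H+d')'+K_{\mathcal E}G)'}{1+K_{\mathcal E}+(H+d')\Sigma_s(H+d')'},\qquad \mathcal P=d'\Sigma_sd+K_{\mathcal E},$$ where $Q=F+Gd'$, then $K_{\mathcal E}=0$.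
   Context: $'$ denotes transpose and $\log$ is to base 2; $\mathcal P>0$ is the power budget. Channel. $\mathcal Z(z)$ is a single-input single-output finite-dimensional LTI transfer function, stable and minimum phase, with $\mathcal Z(\infty)=1$. $\mathcal Z^{-1}$ has minimal realization $(F,G,H,1)$ with $F\in\mathbb R^{m\times m}$ stable, $m\ge1$. $\{N_t\}$ is white Gaussian noise, zero mean, unit variance. The channel is $s_{t+1}=Fs_t+Gu_t$, $y_t=Hs_t+u_t+N_t$, $s_0=0$. $C_\infty(\mathcal P)$ is the asymptotic feedback capacity: the supremum of $\lim_{T\to\infty}\frac1{T+1}I(u^T\to y^T)$, with $I(u^T\to y^T)=\sum_{t=0}^TI(u^t;y_t\mid y^{t-1})$, over (asymptotically) stationary inputs $u_t=\gamma_tu^{t-1}+\eta_ty^{t-1}+\xi_t$ ($\gamma_t,\eta_t\in\mathbb R^{1\times t}$, $\xi_t$ zero-mean Gaussian independent of $u^{t-1},y^{t-1}$) with $\lim_{T\to\infty}\frac1{T+1}\mathbf E(u^T)'u^T\le\mathcal P$. It is known (Yang, Kavcic, Tatikonda) that $C_\infty(\mathcal P)$ is given by the maximization displayed in the claim. Gauss-Markov input. $u_t=d'\tilde s_{s,t}+\mathcal E_t$, where $d\in\mathbb R^m$ is a constant gain, $\{\mathcal E_t\}$ is a zero-mean white Gaussian process of variance $K_{\mathcal E}\ge0$, with $\mathcal E_t$ independent of $N^{t-1},u^{t-1},y^{t-1}$, and $\tilde s_{s,t}=s_t-\hat s_{s,t}$ is the error of the Kalman filter $\hat s_{s,t+1}=F\hat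 s_{s,t}+L_{s}e_t$, $e_t=y_t-H\hat s_{s,t}$, $\hat s_{s,0}=0$, with steady-state gain $L_s=\frac{Q\Sigma_s(H+d')'+K_{\mathcal E}G}{1+K_{\mathcal E}+(H+d')\Sigma_s(H+d')'}$; $\Sigma_s\succeq0$ is the steady-state covariance of $\tilde s_{s,t}$, satisfying the Riccati equation in the claim. *)

theory Defs
  imports "HOL-Analysis.Analysis" "HOL-Computational_Algebra.Polynomial"
begin

text \<open>
  Throughout, \<open>G\<close> and \<open>d\<close> stand for column vectors and \<open>H\<close> for the transpose of the row vector
  \<open>H\<close> of the state equations, all three as elements of \<open>real ^ 'n\<close> with \<open>m = CARD('n)\<close>. Thus
  \<open>(H + d')\<Sigma>(H + d')'\<close> is written \<open>(H + d) \<bullet> (S *v (H + d))\<close>.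
\<close>

definition outer :: "real ^ 'n \<Rightarrow> real ^ 'n \<Rightarrow> real ^ 'n ^ 'n"
  where "outer a b = (\<chi> i j. a $ i * b $ j)"

definition psd :: "real ^ 'n ^ 'n \<Rightarrow> bool"
  where "psd S \<longleftrightarrow> transpose S = S \<and> (\<forall>x. 0 \<le> x \<bullet> (S *v x))"

definition complex_vec :: "real ^ 'n \<Rightarrow> complex ^ 'n"
  where "complex_vec v = (\<chi> i. of_real (v $ i))"

definition complex_mat :: "real ^ 'n ^ 'n \<Rightarrow> complex ^ 'n ^ 'n"
  where "complex_mat A = map_matrix of_real A"

definition stable_matrix :: "real ^ 'n ^ 'n \<Rightarrow> bool"
  where "stable_matrix A \<longleftrightarrow>
    (\<forall>l v. v \<noteq> 0 \<and> complex_mat A *v v = l *s v \<longrightarrow> norm l < 1)"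

definition transfer_function :: "real poly \<Rightarrow> real poly \<Rightarrow> complex \<Rightarrow> complex"
  where "transfer_function p q z =
    poly (map_poly of_real p) z / poly (map_poly of_real q) z"

definition roots_in_open_unit_disc :: "real poly \<Rightarrow> bool"
  where "roots_in_open_unit_disc p \<longleftrightarrow>
    (\<forall>z::complex. poly (map_poly of_real p) z = 0 \<longrightarrow> norm z < 1)"

text \<open>
  \<open>p / q\<close> is in lowest terms, so the roots of \<open>q\<close> are exactly the poles (stability) and the roots
  of \<open>p\<close> exactly the zeros (minimum phase).
\<close>

definition channel_filter :: "real poly \<Rightarrow> real poly \<Rightarrow> bool"
  where "channel_filter p q \<longleftrightarrow>
    q \<noteq> 0 \<and> coprime p q \<and>
    roots_in_open_unit_disc q \<and> roots_in_open_unit_disc p \<and>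
    (transfer_function p q \<longlongrightarrow> 1) at_infinity"

text \<open>\<open>T(z) = D + C(zI - A)\<^sup>-\<^sup>1B\<close>\<close>

definition realization ::
  "(complex \<Rightarrow> complex) \<Rightarrow> real ^ 'n ^ 'n \<Rightarrow> real ^ 'n \<Rightarrow> real ^ 'n \<Rightarrow> real \<Rightarrow> bool"
  where "realization T A B C D \<longleftrightarrow>
    (\<forall>z. det (mat z - complex_mat A) \<noteq> 0 \<longrightarrow>
      T z = of_real D + (\<Sum>i\<in>UNIV. complex_vec C $ i *
        (matrix_inv (mat z - complex_mat A) *v complex_vec B) $ i))"

text \<open>
  A realization is minimal if no realization of the same transfer function has fewer states.
  One with \<open>k < CARD('n)\<close> states is represented, by padding with zeros, as a realization over
  \<open>'n\<close> supported on a set of \<open>k\<close> state indices; the padding does not change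
  \<open>D + C(zI - A)\<^sup>-\<^sup>1B\<close>.
\<close>

definition supported_on ::
  "'n set \<Rightarrow> real ^ 'n ^ 'n \<Rightarrow> real ^ 'n \<Rightarrow> real ^ 'n \<Rightarrow> bool"
  where "supported_on I A B C \<longleftrightarrow>
    (\<forall>i j. i \<notin> I \<or> j \<notin> I \<longrightarrow> A $ i $ j = 0) \<and>
    (\<forall>i. i \<notin> I \<longrightarrow> B $ i = 0 \<and> C $ i = 0)"

definition minimal_realization ::
  "(complex \<Rightarrow> complex) \<Rightarrow> real ^ 'n ^ 'n \<Rightarrow> real ^ 'n \<Rightarrow> real ^ 'n \<Rightarrow> real \<Rightarrow> bool"
  where "minimal_realization T A B C D \<longleftrightarrow>
    realization T A B C D \<and>
    (\<forall>I A' B' C' D'. realization T A' B' C' D' \<and> supported_on I A' B' C' \<longrightarrow>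
      CARD('n) \<le> card (I :: 'n set))"

text \<open>
  The stationary Gauss-Markov input is \<open>u\<^sub>t = d' x\<^sub>t + E\<^sub>t\<close>, with \<open>x\<^sub>t\<close> the Kalman filter error for
  the channel state, \<open>S\<close> its covariance, and \<open>K\<close> the variance of the white process \<open>E\<^sub>t\<close>.
\<close>

definition closed_loop :: "real ^ 'n ^ 'n \<Rightarrow> real ^ 'n \<Rightarrow> real ^ 'n \<Rightarrow> real ^ 'n ^ 'n"
  where "closed_loop F G d = F + outer G d"

definition innovation_variance ::
  "real ^ 'n \<Rightarrow> real ^ 'n \<Rightarrow> real \<Rightarrow> real ^ 'n ^ 'n \<Rightarrow> real"
  where "innovation_variance H d K S = 1 + K + (H + d) \<bullet> (S *v (H + d))"

definition gain_numerator ::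
  "real ^ 'n ^ 'n \<Rightarrow> real ^ 'n \<Rightarrow> real ^ 'n \<Rightarrow> real ^ 'n \<Rightarrow> real \<Rightarrow> real ^ 'n ^ 'n \<Rightarrow> real ^ 'n"
  where "gain_numerator F G H d K S = (closed_loop F G d ** S) *v (H + d) + K *\<^sub>R G"

definition riccati ::
  "real ^ 'n ^ 'n \<Rightarrow> real ^ 'n \<Rightarrow> real ^ 'n \<Rightarrow> real ^ 'n \<Rightarrow> real \<Rightarrow> real ^ 'n ^ 'n \<Rightarrow> bool"
  where "riccati F G H d K S \<longleftrightarrow>
    S = closed_loop F G d ** S ** transpose (closed_loop F G d) + K *\<^sub>R outer G G
      - (1 / innovation_variance H d K S) *\<^sub>R
          outer (gain_numerator F G H d K S) (gain_numerator F G H d K S)"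

definition input_power :: "real ^ 'n \<Rightarrow> real \<Rightarrow> real ^ 'n ^ 'n \<Rightarrow> real"
  where "input_power d K S = d \<bullet> (S *v d) + K"

text \<open>
  For \<open>K = 0\<close> the Riccati equation can have several positive semidefinite solutions (\<open>S = 0\<close> is
  always one), so \<open>S\<close> is a decision variable alongside \<open>d\<close> and \<open>K\<close>.
\<close>

definition feasible ::
  "real ^ 'n ^ 'n \<Rightarrow> real ^ 'n \<Rightarrow> real ^ 'n \<Rightarrow> real \<Rightarrow>
    (real ^ 'n) \<times> real \<times> (real ^ 'n ^ 'n) \<Rightarrow> bool"
  where "feasible F G H P = (\<lambda>(d, K, S).
    0 \<le> K \<and> psd S \<and> riccati F G H d K S \<and> P = input_power d K S)"

definition rate :: "real ^ 'n \<Rightarrow> (real ^ 'n) \<times> real \<times> (real ^ 'n ^ 'n) \<Rightarrow> real"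
  where "rate H = (\<lambda>(d, K, S). 1 / 2 * log 2 (innovation_variance H d K S))"

definition achieves_feedback_capacity ::
  "real ^ 'n ^ 'n \<Rightarrow> real ^ 'n \<Rightarrow> real ^ 'n \<Rightarrow> real \<Rightarrow>
    real ^ 'n \<Rightarrow> real \<Rightarrow> real ^ 'n ^ 'n \<Rightarrow> bool"
  where "achieves_feedback_capacity F G H P d K S \<longleftrightarrow>
    is_arg_max (rate H) (feasible F G H P) (d, K, S)"

end

theory Submission
  imports Defs "HOL-Computational_Algebra.Fundamental_Theorem_Algebra"
begin

text \<open>
  In the variables \<open>S\<close> (state covariance), \<open>g = S d\<close> (state-input covariance) and the power \<open>P\<close>, the
  problem is convex: the Riccati right-hand side is the prediction covariance, which is monotone in
  \<open>S\<close> for fixed \<open>g\<close> and \<open>P\<close>, and the output variance \<open>1 + H'SH + 2H'g + P\<close> is affine. Hence the Riccati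
  equation may be relaxed to the inequality \<open>S \<le> prediction\<close>: iterating the Riccati map from a
  subsolution, with \<open>g\<close> and \<open>P\<close> fixed, increases (bounded by the Gramian \<open>W\<close> below) to a feasible point of the same power.

  Let \<open>A = F - GH'\<close>. It is stable because the zeros of \<open>Z\<^sup>-\<^sup>1\<close> are the poles of \<open>Z\<close>, so there is a Gramian
  \<open>W = AWA' + GG'\<close>, and \<open>H'WH > 0\<close> because \<open>Z\<close> is not constant. If \<open>K > 0\<close>, the kernel of \<open>S\<close> is contained
  in that of \<open>W\<close>, so for small \<open>\<epsilon>\<close> the move \<open>S - \<epsilon>W\<close>, \<open>g + \<epsilon>WH\<close> keeps the joint covariance of state and
  input positive semidefinite. It yields a subsolution of the same power whose output variance is
  larger by \<open>\<epsilon>H'WH\<close>, contradicting optimality.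
\<close>

section \<open>Powers of stable matrices\<close>

text \<open>Horner's rule for \<open>p(A) v\<close>. Acting on a vector makes it enough to
  annihilate that vector rather than all of \<open>A\<close>.\<close>

definition poly_apply :: "complex ^ 'n ^ 'n \<Rightarrow> complex poly \<Rightarrow> complex ^ 'n \<Rightarrow> complex ^ 'n"
  where "poly_apply A p v = fold_coeffs (\<lambda>a w. a *s v + A *v w) p 0"

lemma poly_apply_0 [simp]: "poly_apply A 0 v = 0"
  by (simp add: poly_apply_def)

lemma poly_apply_pCons [simp]: "poly_apply A (pCons a p) v = a *s v + A *v poly_apply A p v"
  by (cases "p = 0 \<and> a = 0") (auto simp: poly_apply_def)

lemma poly_apply_add: "poly_apply A (p + q) v = poly_apply A p v + poly_apply A q v"
  by (induction p q rule: poly_induct2)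
    (simp_all add: vec.scale_left_distrib matrix_vector_right_distrib)

lemma poly_apply_diff: "poly_apply A (p - q) v = poly_apply A p v - poly_apply A q v"
  by (induction p q rule: poly_induct2)
    (simp_all add: vec.scale_left_diff_distrib matrix_vector_right_distrib vec.diff)

lemma poly_apply_smult: "poly_apply A (smult c p) v = c *s poly_apply A p v"
  by (induction p) (simp_all add: vec.scale_right_distrib vec.scale_scale matrix_vector_mult_scaleR vector_scalar_commute)

lemma poly_apply_monom: "poly_apply A (monom c k) v = c *s (((*v) A ^^ k) v)"
  by (induction k) (simp_all add: monom_0 monom_Suc vector_scalar_commute)

lemma poly_apply_sum: "finite I \<Longrightarrow> poly_apply A (sum p I) v = (\<Sum>i\<in>I. poly_apply A (p i) v)"
  by (induction I rule: finite_induct) (simp_all add: poly_apply_add)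

lemma poly_apply_linear_factor:
  "poly_apply A ([:- l, 1:] * q) v = A *v poly_apply A q v - l *s poly_apply A q v"
  by (simp add: poly_apply_diff poly_apply_smult)

text \<open>\<open>q(A)\<close> commutes with \<open>A - l\<close>. Hence \<open>q\<close>
  annihilates \<open>(A - l) v\<close> as soon as \<open>q(A) v\<close> satisfies the eigenvector
  equation for \<open>l\<close>.\<close>

lemma poly_apply_linear_factor_arg:
  "poly_apply A q (A *v v - l *s v) = A *v poly_apply A q v - l *s poly_apply A q v"
proof (induction q)
  case (pCons a q)
  show ?case
    by (simp add: pCons.IH matrix_vector_right_distrib vec.diff vec.scale
        vec.scale_right_distrib vec.scale_right_diff_distrib mult.commute)
qed simp

text \<open>The \<open>CARD('n) + 1\<close> vectors \<open>v, A v, ...\<close> cannot be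
  independent. A repetition among them is treated first, because dependence is a property of their
  set and would not see it.\<close>

lemma annihilating_polynomial:
  fixes A :: "complex ^ 'n ^ 'n"
  obtains p where "p \<noteq> 0" "poly_apply A p v = 0"
proof (cases "inj_on (\<lambda>i. ((*v) A ^^ i) v) {..CARD('n)}")
  case False
  then obtain i j where ij: "i \<noteq> j" "((*v) A ^^ i) v = ((*v) A ^^ j) v"
    by (auto simp: inj_on_def)
  have "poly_apply A (monom 1 i + monom (- 1) j) v = 0"
    using ij by (simp add: poly_apply_add poly_apply_monom)
  moreover have "coeff (monom 1 i + monom (- 1 :: complex) j) i \<noteq> 0"
    using ij(1) by simp
  then have "monom 1 i + monom (- 1 :: complex) j \<noteq> 0"
    by (metis coeff_0)
  ultimately show ?thesis using that by blast
next
  case True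
  let ?B = "\<lambda>i. ((*v) A ^^ i) v"
  have card: "card (?B ` {..CARD('n)}) = Suc (CARD('n))"
    using True by (simp add: card_image)
  have "vec.dependent (?B ` {..CARD('n)})"
    using card vec.independent_card_le_dim[of "?B ` {..CARD('n)}" UNIV]
    by (auto simp: card_cart_basis)
  then obtain u w where w: "w \<in> ?B ` {..CARD('n)}" "u w \<noteq> 0"
    and sum0: "(\<Sum>x\<in>?B ` {..CARD('n)}. u x *s x) = 0"
    by (auto simp: vec.dependent_finite)
  define p where "p = (\<Sum>i\<le>CARD('n). monom (u (?B i)) i)"
  have "poly_apply A p v = (\<Sum>i\<le>CARD('n). u (?B i) *s ?B i)"
    by (simp add: p_def poly_apply_sum poly_apply_monom)
  also have "\<dots> = 0"
    using sum0 sum.reindex[OF True, of "\<lambda>x. u x *s x"] by simp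
  finally have "poly_apply A p v = 0" .
  moreover obtain k where k: "k \<le> CARD('n)" "w = ?B k" using w by auto
  have "coeff p k = u w"
    using k by (simp add: p_def coeff_sum)
  then have "p \<noteq> 0" using w by auto
  ultimately show ?thesis using that by blast
qed

text \<open>Summing the recursion bounds each partial sum \<open>s\<close> by
  \<open>a 0 + c * s + suminf b\<close>, which can be solved for \<open>s\<close> since
  \<open>c < 1\<close>.\<close>

lemma summable_recursive_bound:
  fixes a b :: "nat \<Rightarrow> real"
  assumes "\<And>k. 0 \<le> a k" and "\<And>k. 0 \<le> b k" and "summable b"
    and c: "0 \<le> c" "c < 1" and step: "\<And>k. a (Suc k) \<le> c * a k + b k"
  shows "summable a"
proof (rule bounded_imp_summable)
  show "0 \<le> a k" for k by fact
  fix n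
  define s where "s = (\<Sum>k\<le>n. a k)"
  have "s \<le> (\<Sum>k\<le>Suc n. a k)"
    using assms(1) by (simp add: s_def)
  also have "\<dots> = a 0 + (\<Sum>k\<le>n. a (Suc k))"
    by (rule sum.atMost_Suc_shift)
  also have "\<dots> \<le> a 0 + (\<Sum>k\<le>n. c * a k + b k)"
    using step by (intro add_left_mono sum_mono) auto
  also have "\<dots> = a 0 + c * s + (\<Sum>k\<le>n. b k)"
    by (simp add: s_def sum.distrib sum_distrib_left)
  also have "(\<Sum>k\<le>n. b k) \<le> suminf b"
    using assms(2,3) by (intro sum_le_suminf) auto
  finally have "s * (1 - c) \<le> a 0 + suminf b" by (simp add: algebra_simps)
  then show "(\<Sum>k\<le>n. a k) \<le> (a 0 + suminf b) / (1 - c)"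
    using c by (simp add: s_def pos_le_divide_eq)
qed

lemma norm_vector_scalar_mult_complex: "norm (c *s v) = norm c * norm v"
  for c :: complex and v :: "complex ^ 'n"
  by (simp add: norm_vec_def L2_set_def vector_scalar_mult_def norm_mult power_mult_distrib
      sum_distrib_left[symmetric] real_sqrt_mult)

text \<open>Induction on the degree of an annihilator of \<open>v\<close> replaces the Jordan form.
  If \<open>p = (X - l) q\<close>, then either \<open>q\<close> already annihilates
  \<open>v\<close>, or \<open>q(A) v\<close> is an eigenvector and \<open>norm l < 1\<close>. In the
  second case \<open>q\<close> annihilates \<open>w = (A - l) v\<close>, and
  \<open>A^(k+1) v = l A^k v + A^k w\<close> is a contraction with a summable forcing term.\<close>

lemma summable_matrix_powers_complex:
  fixes A :: "complex ^ 'n ^ 'n"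
  assumes stable: "\<And>l v. v \<noteq> 0 \<Longrightarrow> A *v v = l *s v \<Longrightarrow> norm l < 1"
  shows "summable (\<lambda>k. norm (((*v) A ^^ k) v))"
proof -
  have "summable (\<lambda>k. norm (((*v) A ^^ k) v))" if "p \<noteq> 0" "poly_apply A p v = 0" for p v
    using that
  proof (induction "degree p" arbitrary: p v rule: less_induct)
    case less
    show ?case
    proof (cases "degree p = 0")
      case True
      then obtain a where "p = [:a:]" by (meson degree_eq_zeroE)
      with less.prems have "v = 0" by simp
      moreover have "((*v) A ^^ k) 0 = 0" for k by (induction k) auto
      ultimately show ?thesis by simp
    next
      case False
      then obtain l where "poly p l = 0"
        using fundamental_theorem_of_algebra[of p] constant_degree[of p] by auto
      then obtain q where q: "p = [:- l, 1:] * q" by (metis dvdE poly_eq_0_iff_dvd)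
      with less.prems have "q \<noteq> 0" by auto
      then have deg: "degree q < degree p" by (simp add: q degree_mult_eq del: mult_pCons_left)
      let ?w = "A *v v - l *s v"
      have ker: "A *v poly_apply A q v = l *s poly_apply A q v"
        using less.prems(2) unfolding q poly_apply_linear_factor by simp
      show ?thesis
      proof (cases "poly_apply A q v = 0")
        case True
        then show ?thesis using less.hyps deg \<open>q \<noteq> 0\<close> by blast
      next
        case False
        then have l: "norm l < 1" using ker stable by blast
        have "poly_apply A q ?w = 0"
          using ker by (simp add: poly_apply_linear_factor_arg)
        then have w: "summable (\<lambda>k. norm (((*v) A ^^ k) ?w))"
          using less.hyps deg \<open>q \<noteq> 0\<close> by blast
        have step: "((*v) A ^^ Suc k) v = l *s ((*v) A ^^ k) v + ((*v) A ^^ k) ?w" for k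
          by (induction k) (simp_all add: matrix_vector_right_distrib vec.scale)
        show ?thesis
        proof (rule summable_recursive_bound[OF _ _ w _ l])
          show "norm (((*v) A ^^ Suc k) v)
              \<le> norm l * norm (((*v) A ^^ k) v) + norm (((*v) A ^^ k) ?w)" for k
            unfolding step norm_vector_scalar_mult_complex[symmetric] by (rule norm_triangle_ineq)
        qed auto
      qed
    qed
  qed
  then show ?thesis using annihilating_polynomial by metis
qed

lemma complex_vec_mult: "complex_vec (A *v v) = complex_mat A *v complex_vec v"
  by (simp add: complex_vec_def complex_mat_def map_matrix_def matrix_vector_mult_def vec_eq_iff)

lemma norm_complex_vec: "norm (complex_vec v) = norm v"
  by (simp add: complex_vec_def norm_vec_def)

lemma summable_matrix_powers:
  assumes "stable_matrix A"
  shows "summable (\<lambda>k. norm (((*v) A ^^ k) v))"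
proof -
  have "complex_vec (((*v) A ^^ k) v) = ((*v) (complex_mat A) ^^ k) (complex_vec v)" for k
    by (induction k) (simp_all add: complex_vec_mult)
  then have "norm (((*v) A ^^ k) v) = norm (((*v) (complex_mat A) ^^ k) (complex_vec v))" for k
    by (metis norm_complex_vec)
  then show ?thesis
    using summable_matrix_powers_complex[of "complex_mat A"] assms
    by (auto simp: stable_matrix_def)
qed

section \<open>Zero dynamics of the realization\<close>

abbreviation cdot :: "complex ^ 'n \<Rightarrow> complex ^ 'n \<Rightarrow> complex"
  where "cdot a b \<equiv> (\<Sum>i\<in>UNIV. a $ i * b $ i)"

lemma cdot_diff: "cdot a (b - c) = cdot a b - cdot a c"
  by (simp add: algebra_simps sum_subtractf)

lemma cdot_scale: "cdot a (c *s b) = c * cdot a b"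
  by (simp add: sum_distrib_left mult.left_commute)

lemma norm_cdot_le: "norm (cdot a b) \<le> (\<Sum>i\<in>UNIV. norm (a $ i)) * norm b"
proof -
  have "norm (cdot a b) \<le> (\<Sum>i\<in>UNIV. norm (a $ i * b $ i))" by (rule norm_sum)
  also have "\<dots> \<le> (\<Sum>i\<in>UNIV. norm (a $ i) * norm b)"
    by (intro sum_mono) (auto simp: norm_mult intro!: mult_left_mono Finite_Cartesian_Product.norm_nth_le)
  finally show ?thesis by (simp add: sum_distrib_right)
qed

lemma cdot_complex_vec: "cdot (complex_vec a) (complex_vec b) = of_real (a \<bullet> b)"
  by (simp add: complex_vec_def inner_vec_def)

lemma complex_mat_rank_one_update:
  "complex_mat (A - outer b c) *v v = complex_mat A *v v - cdot (complex_vec c) v *s complex_vec b"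
  by (simp add: vec_eq_iff complex_mat_def complex_vec_def map_matrix_def outer_def
      matrix_vector_mult_def sum_subtractf sum_distrib_left algebra_simps)

lemma outer_mult: "outer b c *v v = (c \<bullet> v) *\<^sub>R b"
  by (simp add: vec_eq_iff outer_def matrix_vector_mult_def inner_vec_def sum_distrib_left mult_ac)


lemma mat_complex_mult: "(mat l - complex_mat A) *v x = l *s x - complex_mat A *v x"
proof -
  have "mat l *v x = l *s x"
    by (simp add: vec_eq_iff mat_def matrix_vector_mult_def if_distrib[of "\<lambda>t. t * _"]
        sum.delta cong: if_cong)
  then show ?thesis by (simp add: matrix_vector_mult_diff_rdistrib)
qed

lemma stable_resolvent_unique:
  assumes "stable_matrix A" "norm l \<ge> 1" "l *s x = complex_mat A *v x"
  shows "x = 0"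
  using assms unfolding stable_matrix_def by (metis linorder_not_le)

text \<open>A stable matrix has no eigenvalue with \<open>norm l \<ge> 1\<close>, so the resolvent
  exists there and \<open>x\<close> is \<open>(l I - A)^-1 B\<close>.\<close>

lemma realization_outside_disc:
  assumes "realization T A B C D" "stable_matrix A" "norm l \<ge> 1"
  obtains x where "l *s x - complex_mat A *v x = complex_vec B"
    "T l = of_real D + cdot (complex_vec C) x"
proof -
  let ?M = "mat l - complex_mat A"
  have "\<exists>N. N ** ?M = mat 1"
    unfolding matrix_left_invertible_ker mat_complex_mult
    using stable_resolvent_unique[OF assms(2,3)] by simp
  then have inv: "invertible ?M" by (simp add: invertible_left_inverse)
  then have "det ?M \<noteq> 0" by (simp add: invertible_det_nz)
  with assms(1) have "T l = of_real D + cdot (complex_vec C) (matrix_inv ?M *v complex_vec B)"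
    by (simp add: realization_def)
  moreover have "?M *v (matrix_inv ?M *v complex_vec B) = complex_vec B"
  proof -
    have "?M ** matrix_inv ?M = mat 1"
      using someI_ex[OF inv[unfolded invertible_def]] by (simp add: matrix_inv_def)
    then show ?thesis by (simp add: matrix_vector_mul_assoc)
  qed
  ultimately show ?thesis using that mat_complex_mult by metis
qed

text \<open>For \<open>norm l \<ge> 1\<close> put \<open>x = (l I - F)^-1 G\<close>. An eigenvector
  \<open>v\<close> of \<open>F - G H'\<close> for \<open>l\<close> would be the multiple
  \<open>- (H' v) x\<close>, which forces \<open>H' x = -1\<close>, so that the inverse channel
  would vanish at \<open>l\<close>.\<close>

lemma stable_zero_dynamics:
  assumes real: "realization (\<lambda>z. inverse (transfer_function p q z)) F G H 1"
    and F: "stable_matrix F"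
    and p: "roots_in_open_unit_disc p" and q: "roots_in_open_unit_disc q"
  shows "stable_matrix (F - outer G H)"
  unfolding stable_matrix_def
proof (intro allI impI, elim conjE)
  fix l v
  assume v: "v \<noteq> 0" and eig: "complex_mat (F - outer G H) *v v = l *s v"
  show "norm l < 1"
  proof (rule ccontr)
    assume "\<not> norm l < 1"
    then have l: "norm l \<ge> 1" by simp
    obtain x where x: "l *s x - complex_mat F *v x = complex_vec G"
      and T: "inverse (transfer_function p q l) = 1 + cdot (complex_vec H) x"
      using realization_outside_disc[OF real F l] by auto
    define c where "c = cdot (complex_vec H) v"
    have "l *s v = complex_mat F *v v - c *s complex_vec G"
      using eig by (simp add: complex_mat_rank_one_update c_def)
    then have "l *s (v + c *s x) = complex_mat F *v (v + c *s x)"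
      unfolding x[symmetric]
      by (simp add: matrix_vector_right_distrib vec.scale vec.scale_right_distrib
          vec.scale_right_diff_distrib mult.commute)
    then have "v + c *s x = 0" by (rule stable_resolvent_unique[OF F l])
    then have vx: "v = (- c) *s x" by (simp add: eq_neg_iff_add_eq_0 vec.scale_minus_left)
    with v have "c \<noteq> 0" by auto
    moreover have "c = (- c) * cdot (complex_vec H) x"
      using arg_cong[OF vx, of "cdot (complex_vec H)"] unfolding cdot_scale c_def[symmetric] .
    ultimately have "cdot (complex_vec H) x = - 1"
      by (metis mult_cancel_left mult_minus1_right mult_minus_left minus_equation_iff)
    with T have "transfer_function p q l = 0" by simp
    \<comment> \<open>Division by zero yields zero, so a vanishing quotient leaves two cases; the
      roots of both polynomials lie inside the disc.\<close>
    then have "poly (map_poly of_real p) l = 0 \<or> poly (map_poly of_real q) l = 0"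
      by (simp add: transfer_function_def)
    then show False using p q l by (force simp: roots_in_open_unit_disc_def)
  qed
qed

text \<open>If all these numbers vanish, so do all \<open>H' F^k G\<close>, because \<open>F\<close>
  and \<open>F - G H'\<close> agree on vectors orthogonal to \<open>H\<close>. Then the inverse
  channel is 1 outside the disc, so \<open>p = q\<close>, coprimality makes both constant, and the
  zero realization without states contradicts minimality.\<close>

lemma inverse_markov_parameter_nonzero:
  fixes F :: "real ^ 'n ^ 'n"
  assumes filter: "channel_filter p q"
    and minimal: "minimal_realization (\<lambda>z. inverse (transfer_function p q z)) F G H 1"
    and F: "stable_matrix F"
  obtains k where "((*v) (F - outer G H) ^^ k) G \<bullet> H \<noteq> 0"
proof (rule ccontr)
  assume "\<not> thesis"
  with that have zero: "((*v) (F - outer G H) ^^ k) G \<bullet> H = 0" for k by blast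
  have "F *v u = (F - outer G H) *v u" if "u \<bullet> H = 0" for u
    using that by (simp add: matrix_vector_mult_diff_rdistrib outer_mult inner_commute)
  with zero have "((*v) F ^^ k) G = ((*v) (F - outer G H) ^^ k) G" for k
    by (induction k) simp_all
  with zero have zeroF: "H \<bullet> ((*v) F ^^ k) G = 0" for k by (simp add: inner_commute)
  let ?T = "\<lambda>z. inverse (transfer_function p q z)" and ?F = "complex_mat F"
  have real: "realization ?T F G H 1" using minimal by (simp add: minimal_realization_def)
  have T1: "?T l = 1" if l: "norm l \<ge> 1" for l
  proof -
    obtain x where x: "l *s x - ?F *v x = complex_vec G"
      and T: "?T l = 1 + cdot (complex_vec H) x"
      using realization_outside_disc[OF real F l] by auto
    \<comment> \<open>This sequence satisfies \<open>h (Suc k) = l * h k\<close> and yet tends to 0,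
      so \<open>h 0 = 0\<close> because \<open>norm l \<ge> 1\<close>.\<close>
    define h where "h k = cdot (complex_vec H) (((*v) ?F ^^ k) x)" for k
    have G: "((*v) ?F ^^ k) (complex_vec G) = complex_vec (((*v) F ^^ k) G)" for k
      by (induction k) (simp_all add: complex_vec_mult)
    have "l *s ((*v) ?F ^^ k) x - ((*v) ?F ^^ Suc k) x = ((*v) ?F ^^ k) (complex_vec G)" for k
    proof (induction k)
      case (Suc k)
      have "?F *v (l *s ((*v) ?F ^^ k) x - ((*v) ?F ^^ Suc k) x)
          = ?F *v ((*v) ?F ^^ k) (complex_vec G)"
        using Suc by simp
      then show ?case by (simp add: vec.scale vec.diff)
    qed (simp add: x)
    then have "l * h k - h (Suc k) = 0" for k
      unfolding h_def cdot_scale[symmetric] cdot_diff[symmetric]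
      by (simp add: G cdot_complex_vec zeroF del: funpow.simps vector_minus_component vector_smult_component)
    then have step: "h (Suc k) = l * h k" for k by simp
    have hk: "h k = l ^ k * h 0" for k
      by (induction k) (simp_all add: step)
    have "summable (\<lambda>k. norm (((*v) ?F ^^ k) x))"
      using F by (intro summable_matrix_powers_complex) (auto simp: stable_matrix_def)
    then have "(\<lambda>k. (\<Sum>i\<in>UNIV. norm (complex_vec H $ i)) * norm (((*v) ?F ^^ k) x)) \<longlonglongrightarrow> 0"
      by (intro tendsto_mult_right_zero summable_LIMSEQ_zero)
    then have h0: "h \<longlonglongrightarrow> 0"
      by (rule Lim_null_comparison[rotated]) (auto simp: h_def norm_cdot_le)
    have "norm (h 0) \<le> norm (h k)" for k
      using l mult_right_mono[of 1 "norm l ^ k" "norm (h 0)"]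
      by (simp add: hk[of k] norm_mult norm_power one_le_power)
    then have "norm (h 0) \<le> 0"
      using tendsto_norm[OF h0] by (intro LIMSEQ_le_const[of "\<lambda>k. norm (h k)"]) auto
    then show ?thesis using T by (simp add: h_def)
  qed
  let ?p = "map_poly complex_of_real p" and ?q = "map_poly complex_of_real q"
  have eq: "poly (?p - ?q) l = 0" if "norm l \<ge> 1" for l
    using T1[OF that] by (auto simp: transfer_function_def divide_simps split: if_splits)
  have "?p - ?q = 0"
  proof (rule ccontr)
    assume "?p - ?q \<noteq> 0"
    then have "finite {l. poly (?p - ?q) l = 0}" by (rule poly_roots_finite)
    moreover have "range (\<lambda>n. of_nat (Suc n)) \<subseteq> {l. poly (?p - ?q) l = 0}"
      using eq by (auto simp del: of_nat_Suc poly_diff)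
    moreover have "infinite (range (\<lambda>n. of_nat (Suc n) :: complex))"
      by (intro range_inj_infinite) (auto simp: inj_on_def)
    ultimately show False using finite_subset by blast
  qed
  then have pq: "p = q"
    by (metis (no_types, lifting) coeff_map_poly eq_iff_diff_eq_0 of_real_0 of_real_eq_iff poly_eqI)
  with filter have "is_unit p" "p \<noteq> 0" by (auto simp: channel_filter_def)
  then obtain c where "p = [:c:]" "c \<noteq> 0" by (auto simp: is_unit_poly_iff)
  then have T: "?T = (\<lambda>z. 1)" by (auto simp: fun_eq_iff transfer_function_def pq[symmetric] map_poly_pCons)
  have "realization ?T (0 :: real ^ 'n ^ 'n) 0 0 1" "supported_on {} (0 :: real ^ 'n ^ 'n) 0 0"
    unfolding T by (auto simp: realization_def supported_on_def complex_vec_def)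
  then have "CARD('n) \<le> card ({} :: 'n set)"
    using minimal unfolding minimal_realization_def by blast
  then show False by simp
qed

section \<open>Positive semidefinite matrices and Gramians\<close>

lemma inner_symmetric_matrix:
  "transpose S = S \<Longrightarrow> v \<bullet> (S *v w) = w \<bullet> (S *v (v :: real ^ 'n))"
  by (metis dot_lmul_matrix inner_commute transpose_matrix_vector)

text \<open>Polarization recovers the bilinear form from the quadratic form. This reduces the
  Riccati equation to an identity of quadratic forms.\<close>

lemma symmetric_matrix_eqI:
  fixes A B :: "real ^ 'n ^ 'n"
  assumes "transpose A = A" "transpose B = B" and eq: "\<And>v. v \<bullet> (A *v v) = v \<bullet> (B *v v)"
  shows "A = B"
proof -
  have "v \<bullet> (A *v w) = v \<bullet> (B *v w)" for v w
    using eq[of "v + w"] eq[of v] eq[of w] inner_symmetric_matrix[OF assms(1), of v w]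
      inner_symmetric_matrix[OF assms(2), of v w]
    by (simp add: matrix_vector_right_distrib inner_add_left inner_add_right)
  then have "A *v w = B *v w" for w by (metis vector_eq_ldot)
  then show ?thesis by (metis matrix_eq)
qed

lemma transpose_outer: "transpose (outer a b) = outer b a"
  by (simp add: vec_eq_iff transpose_def outer_def mult.commute)

lemma transpose_add: "transpose (A + B) = transpose A + transpose B"
  by (simp add: vec_eq_iff transpose_def)

lemma transpose_diff: "transpose (A - B) = transpose A - transpose B"
  by (simp add: vec_eq_iff transpose_def)

lemma matrix_congruence_inner: "v \<bullet> ((A ** S ** transpose A) *v w) = (v v* A) \<bullet> (S *v (w v* A))"
  for A S :: "real ^ 'n ^ 'n"
  by (simp add: matrix_vector_mul_assoc[symmetric] dot_lmul_matrix)

lemma transpose_congruence: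
  fixes A S :: "real ^ 'n ^ 'n"
  shows "transpose S = S \<Longrightarrow> transpose (A ** S ** transpose A) = A ** S ** transpose A"
  by (simp add: matrix_transpose_mul matrix_mul_assoc)

lemma nonneg_quadratic_discriminant:
  fixes a b c :: real
  assumes c: "0 \<le> c" and quad: "\<And>t. 0 \<le> a + 2 * t * b + t\<^sup>2 * c"
  shows "b\<^sup>2 \<le> a * c"
proof (cases "c = 0")
  case True
  have "b = 0"
  proof (rule ccontr)
    assume b: "b \<noteq> 0"
    \<comment> \<open>At this \<open>t\<close> the affine function \<open>a + 2 * t * b\<close>
      takes the value -1.\<close>
    then have "2 * (- (a + 1) / (2 * b)) * b = - (a + 1)" by simp
    then show False using quad[of "- (a + 1) / (2 * b)"] True by simp
  qed
  then show ?thesis using True by simp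
next
  case False
  have "0 \<le> c * (a + 2 * (- b / c) * b + (- b / c)\<^sup>2 * c)"
    using quad[of "- b / c"] c by simp
  also have "\<dots> = a * c - b\<^sup>2"
    using False by (simp add: field_simps power2_eq_square)
  finally show ?thesis by simp
qed

lemma psd_cauchy_schwarz:
  assumes "psd S"
  shows "(v \<bullet> (S *v w))\<^sup>2 \<le> (v \<bullet> (S *v v)) * (w \<bullet> (S *v w))"
proof (rule nonneg_quadratic_discriminant)
  show "0 \<le> w \<bullet> (S *v w)" using assms by (simp add: psd_def)
  fix t
  have "0 \<le> (v + t *\<^sub>R w) \<bullet> (S *v (v + t *\<^sub>R w))" using assms by (simp add: psd_def)
  also have "\<dots> = v \<bullet> (S *v v) + 2 * t * (v \<bullet> (S *v w)) + t\<^sup>2 * (w \<bullet> (S *v w))"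
    using inner_symmetric_matrix[of S v w] assms
    by (simp add: psd_def matrix_vector_right_distrib matrix_vector_mult_scaleR inner_add_left
        inner_add_right power2_eq_square algebra_simps)
  finally show "0 \<le> v \<bullet> (S *v v) + 2 * t * (v \<bullet> (S *v w)) + t\<^sup>2 * (w \<bullet> (S *v w))" .
qed

lemma psd_kernel:
  assumes "psd S" "v \<bullet> (S *v v) = 0"
  shows "S *v v = 0"
proof -
  have "((S *v v) \<bullet> (S *v v))\<^sup>2 \<le> 0"
    using psd_cauchy_schwarz[OF assms(1), of "S *v v" v] assms(2) by simp
  then show ?thesis by simp
qed

text \<open>On the compact set \<open>C\<close> of unit vectors orthogonal to the kernel of
  \<open>S\<close> the form of \<open>S\<close> is positive, so the ratio of the two forms attains a
  maximum \<open>c\<close> unless \<open>C\<close> is empty. The component of \<open>v\<close> in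
  the kernel contributes to neither form.\<close>

lemma psd_dominated:
  fixes S W :: "real ^ 'n ^ 'n"
  assumes S: "psd S" and W: "psd W"
    and ker: "\<And>v. v \<bullet> (S *v v) = 0 \<Longrightarrow> v \<bullet> (W *v v) = 0"
  obtains c where "0 \<le> c" "\<And>v. v \<bullet> (W *v v) \<le> c * (v \<bullet> (S *v v))"
proof -
  define C where "C = sphere 0 1 \<inter> {z. \<forall>y. S *v y = 0 \<longrightarrow> y \<bullet> z = 0}"
  have pos: "0 < z \<bullet> (S *v z)" if "z \<in> C" for z
  proof -
    have "z \<bullet> (S *v z) \<noteq> 0"
    proof
      assume "z \<bullet> (S *v z) = 0"
      then have "S *v z = 0" by (rule psd_kernel[OF S])
      then have "z \<bullet> z = 0" using that by (auto simp: C_def)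
      then show False using that by (auto simp: C_def)
    qed
    then show ?thesis using S by (metis psd_def order_less_le)
  qed
  obtain c where c: "0 \<le> c" "\<And>z. z \<in> C \<Longrightarrow> z \<bullet> (W *v z) \<le> c * (z \<bullet> (S *v z))"
  proof (cases "C = {}")
    case True
    then show ?thesis using that[of 0] by auto
  next
    case False
    have "{z. \<forall>y. S *v y = 0 \<longrightarrow> y \<bullet> z = 0} = (\<Inter>y\<in>{y. S *v y = 0}. {z. y \<bullet> z = 0})" by auto
    then have "closed {z. \<forall>y. S *v y = 0 \<longrightarrow> y \<bullet> z = 0}"
      by (auto intro!: closed_INT closed_Collect_eq continuous_intros)
    then have "compact C" unfolding C_def by (intro compact_Int_closed compact_sphere)
    moreover have "continuous_on C (\<lambda>z. (z \<bullet> (W *v z)) / (z \<bullet> (S *v z)))"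
    proof (rule continuous_on_divide)
      show "\<forall>z\<in>C. z \<bullet> (S *v z) \<noteq> 0" using pos by fastforce
    qed (intro continuous_on_inner continuous_on_id matrix_vector_mult_linear_continuous_on)+
    ultimately obtain z0 where z0: "z0 \<in> C"
      "\<And>z. z \<in> C \<Longrightarrow> (z \<bullet> (W *v z)) / (z \<bullet> (S *v z)) \<le> (z0 \<bullet> (W *v z0)) / (z0 \<bullet> (S *v z0))"
      using continuous_attains_sup[OF _ False] by blast
    show ?thesis
    proof (rule that)
      show "0 \<le> (z0 \<bullet> (W *v z0)) / (z0 \<bullet> (S *v z0))"
        using W pos[OF z0(1)] by (auto simp: psd_def)
      show "z \<bullet> (W *v z) \<le> (z0 \<bullet> (W *v z0)) / (z0 \<bullet> (S *v z0)) * (z \<bullet> (S *v z))" if "z \<in> C" for z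
        using z0(2)[OF that] pos[OF that] by (simp only: pos_divide_le_eq)
    qed
  qed
  have "v \<bullet> (W *v v) \<le> c * (v \<bullet> (S *v v))" for v
  proof -
    obtain y z where y: "y \<in> span {y. S *v y = 0}"
      and z: "\<And>w. w \<in> span {y. S *v y = 0} \<Longrightarrow> orthogonal z w" and v: "v = y + z"
      using orthogonal_subspace_decomp_exists[of "{y. S *v y = 0}" v] by metis
    have "subspace {y. S *v y = 0}"
      by (auto simp: subspace_def matrix_vector_right_distrib matrix_vector_mult_scaleR)
    then have Sy: "S *v y = 0" using y by (simp add: span_eq_iff[THEN iffD2])
    then have Wy: "W *v y = 0" using ker psd_kernel[OF W] by simp
    have sym: "y \<bullet> (S *v z) = 0" "y \<bullet> (W *v z) = 0"
      using inner_symmetric_matrix[of S y z] inner_symmetric_matrix[of W y z] S W Sy Wy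
      by (auto simp: psd_def)
    have eq: "v \<bullet> (S *v v) = z \<bullet> (S *v z)" "v \<bullet> (W *v v) = z \<bullet> (W *v z)"
      using sym Sy Wy by (simp_all add: v matrix_vector_right_distrib inner_add_left)
    show ?thesis
    proof (cases "z = 0")
      case True
      then show ?thesis unfolding eq by simp
    next
      case False
      have "(1 / norm z) *\<^sub>R z \<in> C"
        using False z by (auto simp: C_def orthogonal_def inner_commute span_base)
      from c(2)[OF this] False have "(z \<bullet> (W *v z)) / (norm z)\<^sup>2 \<le> c * (z \<bullet> (S *v z)) / (norm z)\<^sup>2"
        by (simp add: matrix_vector_mult_scaleR power2_eq_square)
      then show ?thesis unfolding eq using False by (simp add: divide_le_cancel)
    qed
  qed
  with c(1) show ?thesis using that by blast
qed

section \<open>Gramians and the discrete Lyapunov equation\<close>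

text \<open>\<open>W\<close> is the sum of the matrices \<open>u_k u_k'\<close> with
  \<open>u_k = A^k g\<close>. Its entries converge because the \<open>u_k\<close> are bounded and
  have summable norms.\<close>

lemma reachability_gramian:
  fixes A :: "real ^ 'n ^ 'n"
  assumes "stable_matrix A"
  obtains W where "transpose W = W"
    "\<And>v. (\<lambda>k. (((*v) A ^^ k) g \<bullet> v)\<^sup>2) sums (v \<bullet> (W *v v))"
proof
  let ?u = "\<lambda>k. ((*v) A ^^ k) g"
  define W :: "real ^ 'n ^ 'n" where "W = (\<chi> i j. \<Sum>k. ?u k $ i * ?u k $ j)"
  show "transpose W = W"
    by (simp add: W_def transpose_def vec_eq_iff mult.commute)
  have u: "summable (\<lambda>k. norm (?u k))" using assms by (rule summable_matrix_powers)
  then obtain c where c: "\<And>k. norm (?u k) \<le> c"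
    using summable_imp_Bseq[of "\<lambda>k. norm (?u k)"] by (auto simp: Bseq_def)
  have sums: "(\<lambda>k. ?u k $ i * ?u k $ j) sums (W $ i $ j)" for i j
  proof -
    have "summable (\<lambda>k. ?u k $ i * ?u k $ j)"
    proof (rule summable_comparison_test'[where N = 0])
      show "summable (\<lambda>k. c * norm (?u k))" using u by (rule summable_mult)
      show "norm (?u k $ i * ?u k $ j) \<le> c * norm (?u k)" for k
      proof -
        have "norm (?u k $ i) \<le> c"
          using Finite_Cartesian_Product.norm_nth_le c by (rule order_trans)
        then show ?thesis
          unfolding norm_mult using Finite_Cartesian_Product.norm_nth_le[of "?u k" j]
          by (intro mult_mono) (auto intro: order_trans[OF norm_ge_zero])
      qed
    qed
    then show ?thesis by (simp add: W_def summable_sums)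
  qed
  fix v
  have "(\<lambda>k. \<Sum>i\<in>UNIV. \<Sum>j\<in>UNIV. v $ i * v $ j * (?u k $ i * ?u k $ j)) sums
      (\<Sum>i\<in>UNIV. \<Sum>j\<in>UNIV. v $ i * v $ j * W $ i $ j)"
    by (intro sums_sum sums_mult sums)
  moreover have "(\<Sum>i\<in>UNIV. \<Sum>j\<in>UNIV. v $ i * v $ j * (x $ i * x $ j)) = (x \<bullet> v)\<^sup>2" for x :: "real ^ 'n"
    by (simp add: inner_vec_def power2_eq_square sum_product mult_ac)
  moreover have "(\<Sum>i\<in>UNIV. \<Sum>j\<in>UNIV. v $ i * v $ j * W $ i $ j) = v \<bullet> (W *v v)"
    by (simp add: inner_vec_def matrix_vector_mult_def sum_distrib_left mult_ac)
  ultimately show "(\<lambda>k. (?u k \<bullet> v)\<^sup>2) sums (v \<bullet> (W *v v))" by simp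
qed

text \<open>Passing from \<open>v\<close> to \<open>v v* A\<close> shifts the series by one index,
  and the missing first term is \<open>(g \<bullet> v)^2\<close>. In matrix form:
  \<open>W = A W A' + g g'\<close>.\<close>

lemma gramian_lyapunov:
  fixes A :: "real ^ 'n ^ 'n"
  assumes "\<And>v. (\<lambda>k. (((*v) A ^^ k) g \<bullet> v)\<^sup>2) sums (v \<bullet> (W *v v))"
  shows "v \<bullet> (W *v v) = (v v* A) \<bullet> (W *v (v v* A)) + (g \<bullet> v)\<^sup>2"
proof -
  have "(\<lambda>k. (((*v) A ^^ Suc k) g \<bullet> v)\<^sup>2) sums ((v v* A) \<bullet> (W *v (v v* A)))"
    using assms[of "v v* A"] by (simp add: dot_lmul_matrix inner_commute[of _ "v v* A"] inner_commute[of _ v])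
  then have "(\<lambda>k. (((*v) A ^^ k) g \<bullet> v)\<^sup>2) sums ((v v* A) \<bullet> (W *v (v v* A)) + (((*v) A ^^ 0) g \<bullet> v)\<^sup>2)"
    by (subst (asm) sums_Suc_iff) auto
  then show ?thesis using assms[of v] sums_unique2 by fastforce
qed

text \<open>Unrolling the inequality \<open>n\<close> times along \<open>y n = (A')^n v\<close>
  leaves a partial sum of the Gramian series plus a remainder in \<open>y n\<close>, which tends to
  0 by stability.\<close>

lemma gramian_maximal:
  fixes A S :: "real ^ 'n ^ 'n"
  assumes A: "stable_matrix A"
    and W: "\<And>v. (\<lambda>k. (((*v) A ^^ k) g \<bullet> v)\<^sup>2) sums (v \<bullet> (W *v v))"
    and le: "\<And>v. v \<bullet> (S *v v) \<le> (v v* A) \<bullet> (S *v (v v* A)) + (g \<bullet> v)\<^sup>2"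
  shows "v \<bullet> (S *v v) \<le> v \<bullet> (W *v v)"
proof -
  define y where "y k = ((\<lambda>v. v v* A) ^^ k) v" for k
  have inner_y: "y k \<bullet> w = v \<bullet> ((*v) A ^^ k) w" for k w
    unfolding y_def by (induction k arbitrary: w) (simp_all add: dot_lmul_matrix funpow_swap1[of "(*v) A"])
  have "(\<lambda>k. y k $ i) \<longlonglongrightarrow> 0" for i
  proof -
    have "(\<lambda>k. norm (((*v) A ^^ k) (axis i 1))) \<longlonglongrightarrow> 0"
      by (rule summable_LIMSEQ_zero[OF summable_matrix_powers[OF A]])
    then have "(\<lambda>k. v \<bullet> ((*v) A ^^ k) (axis i 1)) \<longlonglongrightarrow> v \<bullet> 0"
      by (intro tendsto_inner tendsto_const) (simp add: tendsto_norm_zero_iff)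
    moreover have "y k $ i = v \<bullet> ((*v) A ^^ k) (axis i 1)" for k
      unfolding inner_y[symmetric] by (simp add: inner_axis)
    ultimately show ?thesis by simp
  qed
  then have "y \<longlonglongrightarrow> 0" by (intro vec_tendstoI) simp
  then have "(\<lambda>k. y k \<bullet> (S *v y k)) \<longlonglongrightarrow> 0 \<bullet> (S *v 0)"
    by (intro tendsto_inner bounded_linear.tendsto[OF matrix_vector_mul_bounded_linear])
  then have lim: "(\<lambda>k. v \<bullet> (W *v v) + y k \<bullet> (S *v y k)) \<longlonglongrightarrow> v \<bullet> (W *v v)"
    using tendsto_add[OF tendsto_const] by fastforce
  have "v \<bullet> (S *v v) \<le> (\<Sum>k<n. (((*v) A ^^ k) g \<bullet> v)\<^sup>2) + y n \<bullet> (S *v y n)" for n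
  proof (induction n)
    case (Suc n)
    have "g \<bullet> y n = ((*v) A ^^ n) g \<bullet> v" by (metis inner_y inner_commute)
    then have "y n \<bullet> (S *v y n) \<le> y (Suc n) \<bullet> (S *v y (Suc n)) + (((*v) A ^^ n) g \<bullet> v)\<^sup>2"
      using le[of "y n"] by (simp add: y_def)
    with Suc show ?case by simp
  qed (simp add: y_def)
  moreover have "(\<Sum>k<n. (((*v) A ^^ k) g \<bullet> v)\<^sup>2) \<le> v \<bullet> (W *v v)" for n
    using sum_le_suminf[OF sums_summable[OF W], of "{..<n}"] sums_unique[OF W] by simp
  ultimately have "v \<bullet> (S *v v) \<le> v \<bullet> (W *v v) + y n \<bullet> (S *v y n)" for n
    by (meson add_right_mono order_trans)
  then show ?thesis using lim by (intro LIMSEQ_le_const[OF lim]) auto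
qed

section \<open>Limits of monotone sequences of symmetric matrices\<close>

lemma convergent_divide_const: "convergent X \<Longrightarrow> convergent (\<lambda>n. X n / c)"
  for X :: "nat \<Rightarrow> real"
  unfolding convergent_def divide_inverse by (blast intro: tendsto_mult_right)

lemma monotone_bounded_matrices_converge:
  fixes S :: "nat \<Rightarrow> real ^ 'n ^ 'n"
  assumes sym: "\<And>n. transpose (S n) = S n"
    and mono: "\<And>n v. v \<bullet> (S n *v v) \<le> v \<bullet> (S (Suc n) *v v)"
    and bound: "\<And>n v. v \<bullet> (S n *v v) \<le> b v"
  obtains L where "transpose L = L"
    "\<And>v w. (\<lambda>n. v \<bullet> (S n *v w)) \<longlonglongrightarrow> v \<bullet> (L *v w)"
proof -
  have conv: "convergent (\<lambda>n. v \<bullet> (S n *v v))" for v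
  proof -
    have "incseq (\<lambda>n. v \<bullet> (S n *v v))" using mono by (intro incseq_SucI)
    then obtain l where "(\<lambda>n. v \<bullet> (S n *v v)) \<longlonglongrightarrow> l"
      by (rule incseq_convergent) (use bound in blast)
    then show ?thesis by (rule convergentI)
  qed
  have polar: "v \<bullet> (S n *v w) = ((v + w) \<bullet> (S n *v (v + w)) - v \<bullet> (S n *v v) - w \<bullet> (S n *v w)) / 2" for n v w
    using inner_symmetric_matrix[OF sym, of v n w]
    by (simp add: matrix_vector_right_distrib inner_add_left inner_add_right)
  have "convergent (\<lambda>n. S n $ i $ j)" for i j
  proof -
    have "convergent (\<lambda>n. axis i 1 \<bullet> (S n *v axis j 1))"
      by (subst polar) (intro convergent_divide_const convergent_diff conv)
    then show ?thesis by (simp add: inner_axis' matrix_vector_mult_basis column_def)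
  qed
  then obtain l where l: "\<And>i j. (\<lambda>n. S n $ i $ j) \<longlonglongrightarrow> l i j"
    unfolding convergent_def by (metis (no_types))
  define L where "L = (\<chi> i j. l i j)"
  have "S n $ i $ j = S n $ j $ i" for n i j
    using arg_cong[OF sym[of n], of "\<lambda>M. M $ i $ j"] by (simp add: transpose_def)
  then have "l i j = l j i" for i j using LIMSEQ_unique[OF l[of i j]] l[of j i] by simp
  then have "transpose L = L" by (simp add: L_def transpose_def vec_eq_iff)
  moreover have "(\<lambda>n. v \<bullet> (S n *v w)) \<longlonglongrightarrow> v \<bullet> (L *v w)" for v w
    unfolding inner_vec_def matrix_vector_mult_def
    by (auto simp: L_def intro!: tendsto_intros l)
  ultimately show ?thesis using that by blast
qed

section \<open>The Riccati map\<close>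

text \<open>The covariance of \<open>v' s + a u\<close> and \<open>w' s + b u\<close>, for a state
  \<open>s\<close> with covariance \<open>S\<close>, an input \<open>u\<close> with variance
  \<open>P\<close>, and cross-covariance \<open>g\<close>.\<close>

definition joint_cov ::
  "real ^ 'n ^ 'n \<Rightarrow> real ^ 'n \<Rightarrow> real \<Rightarrow> real ^ 'n \<Rightarrow> real \<Rightarrow> real ^ 'n \<Rightarrow> real \<Rightarrow> real"
  where "joint_cov S g P v a w b = v \<bullet> (S *v w) + a * (g \<bullet> w) + b * (g \<bullet> v) + a * b * P"

definition joint_psd :: "real ^ 'n ^ 'n \<Rightarrow> real ^ 'n \<Rightarrow> real \<Rightarrow> bool"
  where "joint_psd S g P \<longleftrightarrow> transpose S = S \<and> (\<forall>v a. 0 \<le> joint_cov S g P v a v a)"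

text \<open>The variance of the output \<open>H' s + u + N\<close>; the summand 1 is the variance of
  the channel noise \<open>N\<close>.\<close>

definition output_variance :: "real ^ 'n \<Rightarrow> real ^ 'n ^ 'n \<Rightarrow> real ^ 'n \<Rightarrow> real \<Rightarrow> real"
  where "output_variance H S g P = 1 + joint_cov S g P H 1 H 1"

text \<open>The next state satisfies \<open>v' (F s + G u) = (F' v)' s + (G' v) u\<close>. This is
  the part of its variance that remains after linear regression on the output.\<close>

definition prediction_form ::
  "real ^ 'n ^ 'n \<Rightarrow> real ^ 'n \<Rightarrow> real ^ 'n \<Rightarrow> real ^ 'n ^ 'n \<Rightarrow> real ^ 'n \<Rightarrow> real \<Rightarrow> real ^ 'n \<Rightarrow> real"
  where "prediction_form F G H S g P v =
    joint_cov S g P (v v* F) (G \<bullet> v) (v v* F) (G \<bullet> v)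
      - (joint_cov S g P (v v* F) (G \<bullet> v) H 1)\<^sup>2 / output_variance H S g P"

text \<open>The matrix of \<open>prediction_form\<close>; \<open>b\<close> is the covariance of the
  next state with the output.\<close>

definition prediction_cov ::
  "real ^ 'n ^ 'n \<Rightarrow> real ^ 'n \<Rightarrow> real ^ 'n \<Rightarrow> real ^ 'n ^ 'n \<Rightarrow> real ^ 'n \<Rightarrow> real \<Rightarrow> real ^ 'n ^ 'n"
  where "prediction_cov F G H S g P =
    F ** S ** transpose F + outer (F *v g) G + outer G (F *v g) + P *\<^sub>R outer G G
      - (1 / output_variance H S g P) *\<^sub>R
        (let b = F *v (S *v H) + F *v g + (g \<bullet> H + P) *\<^sub>R G in outer b b)"

lemma mult_outer: "v v* outer a b = (a \<bullet> v) *\<^sub>R b"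
  by (metis outer_mult transpose_matrix_vector transpose_outer)

lemma inner_outer_mult: "v \<bullet> (outer a b *v w) = (a \<bullet> v) * (b \<bullet> w)"
  by (simp add: outer_mult inner_commute)

lemma matrix_vector_scaleR_left: "(c *\<^sub>R A) *v v = c *\<^sub>R (A *v v)"
  for A :: "real ^ 'n ^ 'm"
  by (simp add: scaleR_matrix_vector_assoc)

lemmas matrix_form_simps = matrix_vector_mult_add_rdistrib matrix_vector_mult_diff_rdistrib
  matrix_vector_scaleR_left inner_add_left inner_add_right inner_diff_left inner_diff_right
  matrix_vector_right_distrib matrix_vector_mult_diff_distrib matrix_vector_mult_scaleR

lemma prediction_cov_form:
  assumes "transpose S = S"
  shows "v \<bullet> (prediction_cov F G H S g P *v v) = prediction_form F G H S g P v"
proof -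
  define b where "b = F *v (S *v H) + F *v g + (g \<bullet> H + P) *\<^sub>R G"
  have F: "(F *v x) \<bullet> v = (v v* F) \<bullet> x" for x by (metis dot_lmul_matrix inner_commute)
  have b: "b \<bullet> v = joint_cov S g P (v v* F) (G \<bullet> v) H 1"
    by (simp add: b_def joint_cov_def inner_add_left F algebra_simps inner_commute[of g])
  show ?thesis
    unfolding prediction_cov_def prediction_form_def b[symmetric] Let_def b_def[symmetric]
    by (simp add: matrix_form_simps inner_outer_mult matrix_congruence_inner joint_cov_def F
        power2_eq_square inner_commute[of g] algebra_simps del: transpose_matrix_vector)
qed

lemma transpose_prediction_cov:
  "transpose S = S \<Longrightarrow> transpose (prediction_cov F G H S g P) = prediction_cov F G H S g P"
  by (simp add: prediction_cov_def Let_def transpose_add transpose_diff transpose_scalar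
      transpose_outer transpose_congruence algebra_simps)

lemma output_variance_ge_1: "joint_psd S g P \<Longrightarrow> 1 \<le> output_variance H S g P"
  by (simp add: output_variance_def joint_psd_def)

lemma joint_cov_shift:
  assumes "transpose S = S"
  shows "joint_cov S g P (x - l *\<^sub>R y) (a - l * b) (x - l *\<^sub>R y) (a - l * b)
    = joint_cov S g P x a x a - 2 * l * joint_cov S g P x a y b + l\<^sup>2 * joint_cov S g P y b y b"
  using inner_symmetric_matrix[OF assms, of x y]
  by (simp add: joint_cov_def matrix_form_simps power2_eq_square algebra_simps)

text \<open>Completing the square in the gain \<open>l\<close> of a linear predictor.\<close>

lemma prediction_form_gain:
  fixes H :: "real ^ 'n"
  assumes "joint_psd S g P"
  defines "r \<equiv> output_variance H S g P"
  shows "joint_cov S g P (v v* F - l *\<^sub>R H) (G \<bullet> v - l) (v v* F - l *\<^sub>R H) (G \<bullet> v - l) + l\<^sup>2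
    = prediction_form F G H S g P v + r * (l - joint_cov S g P (v v* F) (G \<bullet> v) H 1 / r)\<^sup>2"
proof -
  have "r > 0" using output_variance_ge_1[OF assms(1), of H] by (simp add: r_def)
  define \<eta> where "\<eta> = joint_cov S g P H 1 H 1"
  define j where "j = joint_cov S g P (v v* F) (G \<bullet> v) H 1"
  have "r = 1 + \<eta>" by (simp add: r_def \<eta>_def output_variance_def)
  have "r * (l - j / r)\<^sup>2 = r * l\<^sup>2 - 2 * l * j + j\<^sup>2 / r"
    using \<open>r > 0\<close> by (simp add: power2_diff field_simps power2_eq_square)
  then show ?thesis
    using joint_cov_shift[of S g P "v v* F" l H "G \<bullet> v" 1] assms(1)
    by (simp add: joint_psd_def prediction_form_def r_def[symmetric] \<eta>_def[symmetric]
        j_def[symmetric] \<open>r = 1 + \<eta>\<close> algebra_simps)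
qed

lemma prediction_form_le:
  assumes "joint_psd S g P"
  shows "prediction_form F G H S g P v
    \<le> joint_cov S g P (v v* F - l *\<^sub>R H) (G \<bullet> v - l) (v v* F - l *\<^sub>R H) (G \<bullet> v - l) + l\<^sup>2"
  using prediction_form_gain[OF assms, of v F l H G] output_variance_ge_1[OF assms, of H] by simp

text \<open>The prediction form is a minimum over gains, and for a fixed gain the expression is
  monotone in \<open>S\<close>. The gain optimal for \<open>S'\<close> therefore serves both
  sides.\<close>

lemma prediction_form_mono:
  assumes S: "joint_psd S g P" and S': "joint_psd S' g P"
    and le: "\<And>v. v \<bullet> (S *v v) \<le> v \<bullet> (S' *v v)"
  shows "prediction_form F G H S g P v \<le> prediction_form F G H S' g P v"
proof -
  define l where "l = joint_cov S' g P (v v* F) (G \<bullet> v) H 1 / output_variance H S' g P"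
  let ?x = "v v* F - l *\<^sub>R H"
  have "prediction_form F G H S g P v \<le> joint_cov S g P ?x (G \<bullet> v - l) ?x (G \<bullet> v - l) + l\<^sup>2"
    by (rule prediction_form_le[OF S])
  also have "\<dots> \<le> joint_cov S' g P ?x (G \<bullet> v - l) ?x (G \<bullet> v - l) + l\<^sup>2"
    using le[of ?x] by (simp add: joint_cov_def)
  also have "\<dots> = prediction_form F G H S' g P v"
    unfolding prediction_form_gain[OF S'] by (simp add: l_def)
  finally show ?thesis .
qed

lemma joint_psd_mono:
  assumes "joint_psd S g P" "transpose S' = S'" "\<And>v. v \<bullet> (S *v v) \<le> v \<bullet> (S' *v v)"
  shows "joint_psd S' g P"
  unfolding joint_psd_def
proof (intro conjI allI)
  fix v a
  have "0 \<le> joint_cov S g P v a v a" using assms(1) by (simp add: joint_psd_def)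
  then show "0 \<le> joint_cov S' g P v a v a" using assms(3)[of v] by (simp add: joint_cov_def)
qed fact

text \<open>Riccati iteration with \<open>g\<close> and \<open>P\<close> held fixed: monotonicity
  propagates the subsolution property, \<open>W\<close> bounds the iterates, and continuity of the
  prediction form makes the limit a fixed point.\<close>

lemma riccati_subsolution_extends:
  assumes S0: "joint_psd S0 g P"
    and sub: "\<And>v. v \<bullet> (S0 *v v) \<le> prediction_form F G H S0 g P v"
    and S0_le: "\<And>v. v \<bullet> (S0 *v v) \<le> v \<bullet> (W *v v)"
    and W: "\<And>v. (v v* F - (G \<bullet> v) *\<^sub>R H) \<bullet> (W *v (v v* F - (G \<bullet> v) *\<^sub>R H)) + (G \<bullet> v)\<^sup>2
      \<le> v \<bullet> (W *v v)"
  obtains S where "joint_psd S g P" "\<And>v. v \<bullet> (S0 *v v) \<le> v \<bullet> (S *v v)"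
    "\<And>v. v \<bullet> (S *v v) = prediction_form F G H S g P v"
proof -
  define f where "f S = prediction_cov F G H S g P" for S
  define X where "X n = (f ^^ n) S0" for n
  have X: "joint_psd (X n) g P \<and> (\<forall>v. v \<bullet> (S0 *v v) \<le> v \<bullet> (X n *v v)) \<and>
      (\<forall>v. v \<bullet> (X n *v v) \<le> v \<bullet> (X (Suc n) *v v)) \<and> (\<forall>v. v \<bullet> (X n *v v) \<le> v \<bullet> (W *v v))" for n
  proof (induction n)
    case 0
    have "transpose S0 = S0" using S0 by (simp add: joint_psd_def)
    with S0 sub S0_le show ?case by (simp add: X_def f_def prediction_cov_form)
  next
    case (Suc n)
    then have psd: "joint_psd (X n) g P" and sym: "transpose (X n) = X n"
      by (auto simp: joint_psd_def)
    have XS: "v \<bullet> (X (Suc n) *v v) = prediction_form F G H (X n) g P v" for v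
      by (simp add: X_def f_def[of "(f ^^ n) S0"] prediction_cov_form[OF sym[unfolded X_def]])
    have symS: "transpose (X (Suc n)) = X (Suc n)"
      using transpose_prediction_cov[OF sym] by (simp add: X_def f_def)
    have psdS: "joint_psd (X (Suc n)) g P"
      using joint_psd_mono[OF psd symS] Suc by blast
    have XSS: "v \<bullet> (X (Suc (Suc n)) *v v) = prediction_form F G H (X (Suc n)) g P v" for v
      using prediction_cov_form[OF symS] by (simp add: X_def f_def)
    have "v \<bullet> (X (Suc n) *v v) \<le> v \<bullet> (W *v v)" for v
    proof -
      let ?x = "v v* F - (G \<bullet> v) *\<^sub>R H"
      \<comment> \<open>The gain \<open>G \<bullet> v\<close> cancels the input coefficient, so the
        bound involves neither \<open>g\<close> nor \<open>P\<close>.\<close>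
      have "v \<bullet> (X (Suc n) *v v) \<le> ?x \<bullet> (X n *v ?x) + (G \<bullet> v)\<^sup>2"
        using prediction_form_le[OF psd, of F G H v "G \<bullet> v"] by (simp add: XS joint_cov_def)
      also have "\<dots> \<le> ?x \<bullet> (W *v ?x) + (G \<bullet> v)\<^sup>2" using Suc by simp
      also have "\<dots> \<le> v \<bullet> (W *v v)" by (rule W)
      finally show ?thesis .
    qed
    moreover have "v \<bullet> (X (Suc n) *v v) \<le> v \<bullet> (X (Suc (Suc n)) *v v)" for v
      unfolding XSS XS using prediction_form_mono[OF psd psdS] Suc by blast
    ultimately show ?case using psdS Suc order_trans by blast
  qed
  obtain S where S: "transpose S = S" and lim: "\<And>v w. (\<lambda>n. v \<bullet> (X n *v w)) \<longlonglongrightarrow> v \<bullet> (S *v w)"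
    using monotone_bounded_matrices_converge[of X "\<lambda>v. v \<bullet> (W *v v)"] X
    by (metis joint_psd_def)
  have le: "v \<bullet> (S0 *v v) \<le> v \<bullet> (S *v v)" for v
    using lim[of v v] X by (intro LIMSEQ_le_const) auto
  have psd: "joint_psd S g P" using joint_psd_mono[OF S0 S le] .
  have joint_lim: "(\<lambda>n. joint_cov (X n) g P v a w b) \<longlonglongrightarrow> joint_cov S g P v a w b" for v a w b
    unfolding joint_cov_def by (intro tendsto_intros lim)
  have "(\<lambda>n. prediction_form F G H (X n) g P v) \<longlonglongrightarrow> prediction_form F G H S g P v" for v
    unfolding prediction_form_def output_variance_def
    using output_variance_ge_1[OF psd, of H]
    by (intro tendsto_intros joint_lim) (simp add: output_variance_def)
  moreover have "prediction_form F G H (X n) g P v = v \<bullet> (X (Suc n) *v v)" for n v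
    using prediction_cov_form[of "X n"] X[of n] by (simp add: X_def f_def joint_psd_def)
  ultimately have "v \<bullet> (S *v v) = prediction_form F G H S g P v" for v
    using LIMSEQ_unique[OF LIMSEQ_Suc[OF lim[of v v]]] by simp
  with psd le show ?thesis using that by blast
qed

section \<open>Joint covariances and feedback gains\<close>

text \<open>For \<open>u = d' s + E\<close> with \<open>E\<close> uncorrelated with
  \<open>s\<close>, one has \<open>v' s + a u = (v + a d)' s + a E\<close>.\<close>

lemma joint_cov_feedback:
  assumes "transpose S = S"
  shows "joint_cov S (S *v d) (input_power d K S) v a w b
    = (v + a *\<^sub>R d) \<bullet> (S *v (w + b *\<^sub>R d)) + K * a * b"
  using inner_symmetric_matrix[OF assms, of d v] inner_symmetric_matrix[OF assms, of d w]
  by (simp add: joint_cov_def input_power_def matrix_form_simps algebra_simps inner_commute[of "S *v d"])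

lemma output_variance_feedback:
  assumes "transpose S = S"
  shows "output_variance H S (S *v d) (input_power d K S) = innovation_variance H d K S"
  by (simp add: output_variance_def joint_cov_feedback[OF assms] innovation_variance_def)

lemma closed_loop_transpose_mult: "v v* closed_loop F G d = v v* F + (G \<bullet> v) *\<^sub>R d"
  by (simp add: closed_loop_def vector_matrix_mult_add_rdistrib mult_outer)

lemma riccati_iff_prediction_form:
  assumes S: "transpose S = S"
  shows "riccati F G H d K S \<longleftrightarrow>
    (\<forall>v. v \<bullet> (S *v v) = prediction_form F G H S (S *v d) (input_power d K S) v)"
proof -
  let ?Q = "closed_loop F G d" and ?b = "gain_numerator F G H d K S"
  define R where "R = ?Q ** S ** transpose ?Q + K *\<^sub>R outer G G
      - (1 / innovation_variance H d K S) *\<^sub>R outer ?b ?b"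
  have R: "transpose R = R"
    by (simp add: R_def transpose_add transpose_diff transpose_scalar transpose_outer
        transpose_congruence[OF S])
  have "?b \<bullet> v = (v v* ?Q) \<bullet> (S *v (H + d)) + K * (G \<bullet> v)" for v
    by (simp add: gain_numerator_def inner_add_right matrix_vector_mul_assoc[symmetric]
        inner_commute[of _ v] dot_lmul_matrix)
  then have "v \<bullet> (R *v v) = prediction_form F G H S (S *v d) (input_power d K S) v" for v
    by (simp add: R_def prediction_form_def joint_cov_feedback[OF S] output_variance_feedback[OF S]
        matrix_form_simps matrix_congruence_inner inner_outer_mult closed_loop_transpose_mult
        power2_eq_square mult_ac del: transpose_matrix_vector)
  moreover have "riccati F G H d K S \<longleftrightarrow> S = R" by (simp add: riccati_def R_def)
  ultimately show ?thesis using symmetric_matrix_eqI[OF S R] by auto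
qed

text \<open>Every joint covariance comes from a gain and a noise variance: positivity puts
  \<open>g\<close> into the range of \<open>S\<close>, and \<open>K\<close> is the Schur complement
  \<open>P - d' S d\<close>.\<close>

lemma joint_psd_feedback_gain:
  assumes J: "joint_psd S g P"
  obtains d K where "0 \<le> K" "g = S *v d" "P = input_power d K S"
proof -
  have S: "transpose S = S" using J by (simp add: joint_psd_def)
  obtain y z where y: "y \<in> span (range ((*v) S))"
    and z: "\<And>w. w \<in> span (range ((*v) S)) \<Longrightarrow> orthogonal z w" and g: "g = y + z"
    using orthogonal_subspace_decomp_exists by metis
  have "span (range ((*v) S)) = range ((*v) S)"
    by (simp add: span_eq_iff linear_subspace_image)
  with y obtain d where d: "y = S *v d" by auto
  have "w \<bullet> (S *v z) = 0" for w
    using z[of "S *v w"] inner_symmetric_matrix[OF S, of w z] by (simp add: span_base orthogonal_def)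
  then have Sz: "S *v z = 0" by (metis inner_eq_zero_iff)
  \<comment> \<open>The state form vanishes at \<open>z\<close>, so a nonzero slope
    \<open>g \<bullet> z\<close> would make this variance negative for some
    \<open>t\<close>.\<close>
  have "0 \<le> P + 2 * t * (g \<bullet> z) + t\<^sup>2 * 0" for t
  proof -
    have "0 \<le> joint_cov S g P (t *\<^sub>R z) 1 (t *\<^sub>R z) 1" using J by (simp add: joint_psd_def)
    then show ?thesis using Sz by (simp add: joint_cov_def matrix_vector_mult_scaleR)
  qed
  from nonneg_quadratic_discriminant[OF _ this] have "g \<bullet> z = 0" by simp
  moreover have "y \<bullet> z = 0" using z[OF y] by (simp add: orthogonal_def inner_commute)
  ultimately have "z = 0" by (simp add: g inner_add_left)
  with g d have gd: "g = S *v d" by simp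
  have "0 \<le> joint_cov S g P (- d) 1 (- d) 1" using J by (simp add: joint_psd_def)
  then have "d \<bullet> (S *v d) \<le> P"
    by (simp add: joint_cov_def gd inner_commute[of "S *v d"] vec.neg)
  with gd show ?thesis using that[of "P - d \<bullet> (S *v d)" d] by (simp add: input_power_def)
qed

text \<open>The relaxation loses nothing: the larger fixed point keeps the power, can only raise the
  output variance, and is realized by a feedback gain.\<close>

lemma feasible_of_subsolution:
  assumes S0: "joint_psd S0 g P"
    and sub: "\<And>v. v \<bullet> (S0 *v v) \<le> prediction_form F G H S0 g P v"
    and S0_le: "\<And>v. v \<bullet> (S0 *v v) \<le> v \<bullet> (W *v v)"
    and W: "\<And>v. (v v* F - (G \<bullet> v) *\<^sub>R H) \<bullet> (W *v (v v* F - (G \<bullet> v) *\<^sub>R H)) + (G \<bullet> v)\<^sup>2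
      \<le> v \<bullet> (W *v v)"
  obtains d K S where "feasible F G H P (d, K, S)"
    "output_variance H S0 g P \<le> innovation_variance H d K S"
proof -
  obtain S where J: "joint_psd S g P" and le: "\<And>v. v \<bullet> (S0 *v v) \<le> v \<bullet> (S *v v)"
    and fix_S: "\<And>v. v \<bullet> (S *v v) = prediction_form F G H S g P v"
    using riccati_subsolution_extends[OF assms] by metis
  obtain d K where K: "0 \<le> K" and g: "g = S *v d" and P: "P = input_power d K S"
    using joint_psd_feedback_gain[OF J] by metis
  have S: "transpose S = S" using J by (simp add: joint_psd_def)
  have "0 \<le> v \<bullet> (S *v v)" for v
  proof -
    have "0 \<le> joint_cov S g P v 0 v 0" using J by (simp add: joint_psd_def)
    then show ?thesis by (simp add: joint_cov_def)
  qed
  with S have "psd S" by (simp add: psd_def)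
  moreover have "riccati F G H d K S"
    using fix_S unfolding riccati_iff_prediction_form[OF S] g P by simp
  ultimately have "feasible F G H P (d, K, S)" using K P by (simp add: feasible_def)
  moreover have "output_variance H S0 g P \<le> innovation_variance H d K S"
    using le[of H] unfolding output_variance_feedback[OF S, symmetric] g[symmetric] P[symmetric]
    by (simp add: output_variance_def joint_cov_def)
  ultimately show ?thesis using that by blast
qed

section \<open>Improving a point with positive noise\<close>

lemma joint_psd_feedback:
  assumes "psd S" "0 \<le> K"
  shows "joint_psd S (S *v d) (input_power d K S)"
  using assms by (auto simp: joint_psd_def psd_def joint_cov_feedback mult.assoc)

lemma joint_cov_cauchy_schwarz:
  assumes J: "joint_psd S g P"
  shows "(joint_cov S g P x a y b)\<^sup>2 \<le> joint_cov S g P x a x a * joint_cov S g P y b y b"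
proof (rule nonneg_quadratic_discriminant)
  show "0 \<le> joint_cov S g P y b y b" using J by (simp add: joint_psd_def)
  fix t
  have "0 \<le> joint_cov S g P (x - (- t) *\<^sub>R y) (a - (- t) * b) (x - (- t) *\<^sub>R y) (a - (- t) * b)"
    using J by (simp add: joint_psd_def)
  also have "\<dots> = joint_cov S g P x a x a + 2 * t * joint_cov S g P x a y b + t\<^sup>2 * joint_cov S g P y b y b"
    using J by (subst joint_cov_shift) (simp_all add: joint_psd_def)
  finally show "0 \<le> joint_cov S g P x a x a + 2 * t * joint_cov S g P x a y b
    + t\<^sup>2 * joint_cov S g P y b y b" .
qed

text \<open>Conditioning on an output with unit noise cannot remove a positive variance
  \<open>t\<close> entirely: \<open>t * (1 + \<eta>) = j^2 \<le> t * \<eta>\<close> gives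
  \<open>t = 0\<close>. The input noise \<open>K > 0\<close> then forces
  \<open>G \<bullet> v = 0\<close>. So the kernel of \<open>S\<close> is orthogonal to
  \<open>G\<close> and invariant under \<open>F'\<close>.\<close>

lemma riccati_kernel_invariant:
  assumes S: "psd S" and ric: "riccati F G H d K S" and K: "0 < K" and v: "v \<bullet> (S *v v) = 0"
  shows "G \<bullet> v = 0" "(v v* F) \<bullet> (S *v (v v* F)) = 0"
proof -
  let ?J = "joint_cov S (S *v d) (input_power d K S)"
  have sym: "transpose S = S" using S by (simp add: psd_def)
  have J: "joint_psd S (S *v d) (input_power d K S)" using joint_psd_feedback[OF S] K by simp
  define t where "t = ?J (v v* F) (G \<bullet> v) (v v* F) (G \<bullet> v)"
  define j where "j = ?J (v v* F) (G \<bullet> v) H 1"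
  define \<eta> where "\<eta> = ?J H 1 H 1"
  have nonneg: "0 \<le> t" "0 \<le> \<eta>" using J by (simp_all add: t_def \<eta>_def joint_psd_def)
  have "t - j\<^sup>2 / (1 + \<eta>) = 0"
    using ric v unfolding riccati_iff_prediction_form[OF sym]
    by (simp add: prediction_form_def output_variance_def t_def j_def \<eta>_def)
  then have "t * (1 + \<eta>) = j\<^sup>2" using nonneg by (simp add: field_simps)
  also have "\<dots> \<le> t * \<eta>"
    unfolding t_def j_def \<eta>_def by (rule joint_cov_cauchy_schwarz[OF J])
  finally have "t = 0" using nonneg by (simp add: algebra_simps)
  then have zero: "(v v* F + (G \<bullet> v) *\<^sub>R d) \<bullet> (S *v (v v* F + (G \<bullet> v) *\<^sub>R d)) + K * (G \<bullet> v)\<^sup>2 = 0"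
    by (simp add: t_def joint_cov_feedback[OF sym] power2_eq_square mult.assoc)
  moreover have "0 \<le> w \<bullet> (S *v w)" for w using S by (simp add: psd_def)
  moreover have "0 \<le> K * (G \<bullet> v)\<^sup>2" using K by simp
  ultimately have "K * (G \<bullet> v)\<^sup>2 = 0" by (metis add_nonneg_eq_0_iff)
  then show G: "G \<bullet> v = 0" using K by simp
  show "(v v* F) \<bullet> (S *v (v v* F)) = 0" using zero G by simp
qed

text \<open>Subadditivity of the convex, homogeneous function \<open>x^2 / y\<close>, applied to
  \<open>(j, r)\<close> and \<open>(t * a, t)\<close>.\<close>

lemma square_over_linear_convex:
  fixes j a r t :: real
  assumes "0 < r" "0 \<le> t"
  shows "(j + t * a)\<^sup>2 / (r + t) \<le> j\<^sup>2 / r + t * a\<^sup>2"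
proof -
  have "(j\<^sup>2 / r + t * a\<^sup>2) * (r + t) - (j + t * a)\<^sup>2 = t * (j - r * a)\<^sup>2 / r"
    using assms by (simp add: field_simps power2_eq_square)
  also have "\<dots> \<ge> 0" using assms by simp
  finally show ?thesis using assms by (simp add: pos_divide_le_eq)
qed

text \<open>
  The direction \<open>(-W, WH)\<close> comes from the Lagrangian dual of the convex program: with
  \<open>A = F - GH'\<close>, stationarity would give a multiplier \<open>\<Lambda> \<ge> 0\<close> of the Riccati inequality with
  \<open>\<Lambda> = A'\<Lambda>A - (1 + \<beta>)HH'\<close> and \<open>\<beta> \<ge> 0\<close>, which is impossible for stable \<open>A\<close>; testing this equation
  with \<open>W\<close> gives the direction.
\<close>

lemma positive_noise_not_optimal:
  fixes F :: "real ^ 'n ^ 'n"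
  assumes feas: "feasible F G H P (d, K, S)" and K: "0 < K"
    and stable: "stable_matrix (F - outer G H)"
    and markov: "((*v) (F - outer G H) ^^ k) G \<bullet> H \<noteq> 0"
  obtains d' K' S' where "feasible F G H P (d', K', S')"
    "innovation_variance H d K S < innovation_variance H d' K' S'"
proof -
  from feas have S: "psd S" and ric: "riccati F G H d K S" and P: "P = input_power d K S"
    by (auto simp: feasible_def)
  then have symS: "transpose S = S" by (simp add: psd_def)
  define A where "A = F - outer G H"
  have A: "v v* A = v v* F - (G \<bullet> v) *\<^sub>R H" for v
    by (simp add: A_def vector_matrix_mult_diff_rdistrib mult_outer)
  obtain W where symW: "transpose W = W"
    and sums: "\<And>v. (\<lambda>k. (((*v) A ^^ k) G \<bullet> v)\<^sup>2) sums (v \<bullet> (W *v v))"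
    using reachability_gramian[of A G] stable unfolding A_def by metis
  have partial: "(((*v) A ^^ k) G \<bullet> v)\<^sup>2 \<le> v \<bullet> (W *v v)" for k v
    using sum_le_suminf[OF sums_summable[OF sums], of "{k}" v] sums_unique[OF sums] by simp
  have W: "psd W"
    unfolding psd_def using symW order_trans[OF zero_le_power2 partial] by blast
  define h where "h = H \<bullet> (W *v H)"
  \<comment> \<open>The square of the nonzero Markov parameter is one term of the series for
    \<open>h\<close>.\<close>
  have h: "0 < h"
    unfolding h_def using partial[of k H] markov by (intro less_le_trans[OF _ partial[of k H]]) (simp add: A_def)
  have lyap: "(v v* A) \<bullet> (W *v (v v* A)) + (G \<bullet> v)\<^sup>2 = v \<bullet> (W *v v)" for v
    by (rule gramian_lyapunov[OF sums, symmetric])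

  \<comment> \<open>On the kernel of \<open>S\<close> the maps \<open>A'\<close> and
    \<open>F'\<close> agree and stay in the kernel, so each term of the series for
    \<open>v' W v\<close> vanishes there.\<close>
  have "((*v) A ^^ k) G \<bullet> v = 0" if "v \<bullet> (S *v v) = 0" for k v
    using that
  proof (induction k arbitrary: v)
    case 0
    then show ?case using riccati_kernel_invariant(1)[OF S ric K] by simp
  next
    case (Suc k)
    have "v v* A = v v* F" using riccati_kernel_invariant(1)[OF S ric K Suc.prems] by (simp add: A)
    then have "((*v) A ^^ k) G \<bullet> (v v* A) = 0"
      using Suc.IH riccati_kernel_invariant(2)[OF S ric K Suc.prems] by simp
    then show ?case by (simp add: inner_commute[of _ v] inner_commute[of _ "v v* A"] dot_lmul_matrix)
  qed
  then have "v \<bullet> (W *v v) = 0" if "v \<bullet> (S *v v) = 0" for v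
    using sums_unique2[OF sums[of v] ] that by simp
  then obtain c where c: "0 \<le> c" and W_le: "\<And>v. v \<bullet> (W *v v) \<le> c * (v \<bullet> (S *v v))"
    using psd_dominated[OF S W] by metis

  define \<delta> where "\<delta> = d \<bullet> (S *v d)"
  have "0 \<le> \<delta>" using S by (simp add: \<delta>_def psd_def)
  \<comment> \<open>The first bound lets the state form \<open>s\<close> absorb the loss in
    \<open>J0\<close> below, the second lets \<open>K * a^2\<close> absorb the rest. The summand 1
    covers \<open>c = 0\<close>.\<close>
  define \<epsilon> where "\<epsilon> = min (1 / (4 * c + 1)) (K / (4 * c * \<delta> + h))"
  have den: "0 < 4 * c * \<delta> + h" using c h \<open>0 \<le> \<delta>\<close> by (simp add: add_nonneg_pos)
  have \<epsilon>: "0 < \<epsilon>" using c K den by (simp add: \<epsilon>_def)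
  have "\<epsilon> * (4 * c + 1) \<le> 1"
    using c by (simp add: \<epsilon>_def pos_le_divide_eq[symmetric])
  then have \<epsilon>1: "4 * c * \<epsilon> \<le> 1" using \<epsilon> by (simp add: algebra_simps)
  have \<epsilon>2: "\<epsilon> * (4 * c * \<delta> + h) \<le> K"
    using den by (simp add: \<epsilon>_def pos_le_divide_eq[symmetric])

  define S0 where "S0 = S - \<epsilon> *\<^sub>R W"
  define g where "g = S *v d"
  define g0 where "g0 = g + \<epsilon> *\<^sub>R (W *v H)"
  have WH: "(W *v H) \<bullet> v = v \<bullet> (W *v H)" for v by (rule inner_commute)
  have joint0: "joint_cov S0 g0 P v a w b = joint_cov S g P v a w b
      + \<epsilon> * (a * (w \<bullet> (W *v H)) + b * (v \<bullet> (W *v H)) - v \<bullet> (W *v w))" for v a w b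
    by (simp add: joint_cov_def S0_def g0_def matrix_form_simps WH algebra_simps)
  have J: "joint_psd S g P" unfolding g_def P using joint_psd_feedback[OF S] K by simp
  have W_shift: "(v - a *\<^sub>R H) \<bullet> (W *v (v - a *\<^sub>R H)) = v \<bullet> (W *v v) - 2 * a * (v \<bullet> (W *v H)) + a\<^sup>2 * h" for v a
    using inner_symmetric_matrix[OF symW, of H v]
    by (simp add: h_def matrix_form_simps power2_eq_square algebra_simps)

  have J0: "joint_psd S0 g0 P"
    unfolding joint_psd_def
  proof (intro conjI allI)
    show "transpose S0 = S0" by (simp add: S0_def transpose_diff transpose_scalar symS symW)
    fix v a
    define s where "s = (v + a *\<^sub>R d) \<bullet> (S *v (v + a *\<^sub>R d))"
    \<comment> \<open>Parallelogram law for \<open>v\<close> and \<open>v + 2 a d\<close>, whose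
      midpoint is \<open>v + a d\<close>; it bounds the form at \<open>v\<close> by \<open>s\<close>
      and \<open>\<delta>\<close>.\<close>
    have "0 \<le> (v + (2 * a) *\<^sub>R d) \<bullet> (S *v (v + (2 * a) *\<^sub>R d))" using S by (simp add: psd_def)
    also have "\<dots> = 2 * s + 2 * a\<^sup>2 * \<delta> - v \<bullet> (S *v v)"
      using inner_symmetric_matrix[OF symS, of d v]
      by (simp add: s_def \<delta>_def matrix_form_simps power2_eq_square algebra_simps)
    finally have "v \<bullet> (S *v v) \<le> 2 * s + 2 * a\<^sup>2 * \<delta>" by simp
    then have "c * (v \<bullet> (S *v v)) \<le> c * (2 * s + 2 * a\<^sup>2 * \<delta>)" using c by (rule mult_left_mono)
    then have Wv: "v \<bullet> (W *v v) \<le> c * (2 * s + 2 * a\<^sup>2 * \<delta>)" using W_le order_trans by blast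
    \<comment> \<open>Positivity of \<open>W\<close> at \<open>v + a H\<close> bounds the cross term
      from below.\<close>
    have "0 \<le> (v - (- a) *\<^sub>R H) \<bullet> (W *v (v - (- a) *\<^sub>R H))" using W by (simp add: psd_def)
    then have "- (v \<bullet> (W *v v)) - a\<^sup>2 * h \<le> 2 * a * (v \<bullet> (W *v H))" unfolding W_shift by simp
    then have "- (2 * (c * (2 * s + 2 * a\<^sup>2 * \<delta>)) + a\<^sup>2 * h) \<le> 2 * a * (v \<bullet> (W *v H)) - v \<bullet> (W *v v)"
      using Wv by simp
    then have "\<epsilon> * - (2 * (c * (2 * s + 2 * a\<^sup>2 * \<delta>)) + a\<^sup>2 * h)
        \<le> \<epsilon> * (2 * a * (v \<bullet> (W *v H)) - v \<bullet> (W *v v))"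
      using \<epsilon> by (intro mult_left_mono) auto
    moreover have "joint_cov S g P v a v a = s + K * a\<^sup>2"
      by (simp add: g_def P joint_cov_feedback[OF symS] s_def power2_eq_square)
    moreover have "4 * c * \<epsilon> * s \<le> 1 * s"
      using \<epsilon>1 S by (intro mult_right_mono) (auto simp: s_def psd_def)
    moreover have "\<epsilon> * (4 * c * \<delta> + h) * a\<^sup>2 \<le> K * a\<^sup>2"
      using \<epsilon>2 by (intro mult_right_mono) auto
    ultimately show "0 \<le> joint_cov S0 g0 P v a v a"
      unfolding joint0 by (simp add: algebra_simps)
  qed

  define r where "r = output_variance H S g P"
  have r: "0 < r" using output_variance_ge_1[OF J, of H] by (simp add: r_def)
  \<comment> \<open>At \<open>(H, 1)\<close> the cross terms add \<open>2 * \<epsilon> * h\<close>,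
    while the smaller state covariance removes \<open>\<epsilon> * h\<close>.\<close>
  have r0: "output_variance H S0 g0 P = r + \<epsilon> * h"
    by (simp add: r_def output_variance_def joint0 h_def)
  have fix_S: "v \<bullet> (S *v v) = prediction_form F G H S g P v" for v
    using ric unfolding riccati_iff_prediction_form[OF symS] g_def P by blast

  have sub: "v \<bullet> (S0 *v v) \<le> prediction_form F G H S0 g0 P v" for v
  proof -
    define a x where "a = G \<bullet> v" and "x = v v* F"
    define j where "j = joint_cov S g P x a H 1"
    \<comment> \<open>The Lyapunov equation turns the perturbation of the state term into
      \<open>- v' W v\<close>, matching \<open>S0\<close>, plus \<open>a^2 * h + a^2\<close>.
      Convexity uses up \<open>\<epsilon> * h * a^2\<close>, and \<open>\<epsilon> * a^2\<close> is
      left as slack.\<close>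
    have "x \<bullet> (W *v x) - 2 * a * (x \<bullet> (W *v H)) + a\<^sup>2 * h + a\<^sup>2 = v \<bullet> (W *v v)"
      using lyap[of v] unfolding A W_shift a_def x_def .
    then have "2 * a * (x \<bullet> (W *v H)) - x \<bullet> (W *v x) = a\<^sup>2 * h + a\<^sup>2 - v \<bullet> (W *v v)" by simp
    then have xx: "joint_cov S0 g0 P x a x a
        = joint_cov S g P x a x a + \<epsilon> * (a\<^sup>2 * h + a\<^sup>2 - v \<bullet> (W *v v))"
      by (simp add: joint0)
    have x\<eta>: "joint_cov S0 g0 P x a H 1 = j + \<epsilon> * h * a"
      by (simp add: joint0 j_def h_def)
    have "prediction_form F G H S0 g0 P v = joint_cov S g P x a x a
        + \<epsilon> * (a\<^sup>2 * h + a\<^sup>2 - v \<bullet> (W *v v)) - (j + \<epsilon> * h * a)\<^sup>2 / (r + \<epsilon> * h)"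
      unfolding prediction_form_def r0 a_def[symmetric] x_def[symmetric] xx x\<eta> ..
    moreover have "v \<bullet> (S *v v) = joint_cov S g P x a x a - j\<^sup>2 / r"
      unfolding fix_S prediction_form_def a_def x_def j_def r_def ..
    moreover have "(j + \<epsilon> * h * a)\<^sup>2 / (r + \<epsilon> * h) \<le> j\<^sup>2 / r + \<epsilon> * h * a\<^sup>2"
      using square_over_linear_convex[OF r] \<epsilon> h by simp
    moreover have "0 \<le> \<epsilon> * a\<^sup>2" using \<epsilon> by simp
    moreover have "v \<bullet> (S0 *v v) = v \<bullet> (S *v v) - \<epsilon> * (v \<bullet> (W *v v))"
      by (simp add: S0_def matrix_form_simps)
    ultimately show ?thesis by (simp add: algebra_simps)
  qed

  \<comment> \<open>The gain \<open>G \<bullet> v\<close> again: it makes \<open>S\<close> a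
    Lyapunov subsolution for \<open>A\<close>, hence bounded by the Gramian.\<close>
  have "v \<bullet> (S *v v) \<le> (v v* A) \<bullet> (S *v (v v* A)) + (G \<bullet> v)\<^sup>2" for v
    using prediction_form_le[OF J, of F G H v "G \<bullet> v"] by (simp add: fix_S A joint_cov_def)
  then have S_le: "v \<bullet> (S *v v) \<le> v \<bullet> (W *v v)" for v
    using gramian_maximal[OF _ sums] stable unfolding A_def by blast
  have "v \<bullet> (S0 *v v) \<le> v \<bullet> (W *v v)" for v
  proof -
    have "0 \<le> \<epsilon> * (v \<bullet> (W *v v))" using \<epsilon> W by (simp add: psd_def)
    then show ?thesis using S_le[of v] by (simp add: S0_def matrix_form_simps)
  qed
  then obtain d' K' S' where "feasible F G H P (d', K', S')"
    and "output_variance H S0 g0 P \<le> innovation_variance H d' K' S'"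
    using feasible_of_subsolution[OF J0 sub, of W] lyap unfolding A by (metis order_refl)
  moreover have "innovation_variance H d K S < output_variance H S0 g0 P"
    unfolding r0 using \<epsilon> h by (simp add: r_def g_def P output_variance_feedback[OF symS])
  ultimately show ?thesis using that by (meson less_le_trans)
qed

theorem proposition7:
  fixes num den :: "real poly"
    and F :: "real ^ 'n ^ 'n" and G H d :: "real ^ 'n"
    and P K\<^sub>E :: real and \<Sigma>\<^sub>s :: "real ^ 'n ^ 'n"
  assumes "channel_filter num den"
    and "minimal_realization (\<lambda>z. inverse (transfer_function num den z)) F G H 1"
    and "stable_matrix F"
    and "P > 0"
    and "achieves_feedback_capacity F G H P d K\<^sub>E \<Sigma>\<^sub>s"
  shows "K\<^sub>E = 0"
proof (rule ccontr)
  assume "K\<^sub>E \<noteq> 0"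
  have feas: "feasible F G H P (d, K\<^sub>E, \<Sigma>\<^sub>s)"
    and max: "\<And>y. feasible F G H P y \<Longrightarrow> \<not> rate H (d, K\<^sub>E, \<Sigma>\<^sub>s) < rate H y"
    using assms(5) by (auto simp: achieves_feedback_capacity_def is_arg_max_def)
  from feas \<open>K\<^sub>E \<noteq> 0\<close> have K: "0 < K\<^sub>E" and S: "psd \<Sigma>\<^sub>s" by (auto simp: feasible_def)
  have stable: "stable_matrix (F - outer G H)"
    using assms(1-3) stable_zero_dynamics by (auto simp: channel_filter_def minimal_realization_def)
  obtain k where "((*v) (F - outer G H) ^^ k) G \<bullet> H \<noteq> 0"
    using inverse_markov_parameter_nonzero[OF assms(1-3)] .
  then obtain d' K' S' where better: "feasible F G H P (d', K', S')"
    "innovation_variance H d K\<^sub>E \<Sigma>\<^sub>s < innovation_variance H d' K' S'"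
    using positive_noise_not_optimal[OF feas K stable] by metis
  have "0 < innovation_variance H d K\<^sub>E \<Sigma>\<^sub>s"
    using K S by (simp add: innovation_variance_def psd_def add_pos_nonneg)
  with better(2) have "rate H (d, K\<^sub>E, \<Sigma>\<^sub>s) < rate H (d', K', S')" by (simp add: rate_def)
  with max[OF better(1)] show False by blast
qed

end
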